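(* Let $A_q(G)$ be a Hopf algebra over a field of characteristic zero and let $(A_q(K),\pi)$ be a (left or right) coisotropic quantum subgroup of $A_q(G)$. Let $\alpha\in\mathrm{Aut}(A_q(G))$ be a Hopf algebra automorphism and let $\tilde\alpha:A_q(K)\to A_q(K)$ be the coalgebra automorphism such that $\tilde\alpha\circ\pi=\pi\circ\alpha$. Let $\rho_R:V\to V\otimes A_q(K)$ be a right corepresentation of $A_q(K)$. Then there is the equivalence of right corepresentations of $A_q(G)$ $$\mathrm{ind}_K^G\big((\mathrm{id}\otimes\tilde\alpha)\circ\rho_R\big)=(\mathrm{id}\otimes\alpha)\big(\mathrm{ind}_K^G(\rho_R)\big).$$
   Context: All vector spaces are over a fixed field of characteristic zero. For a Hopf algebra $A$, a left (resp. right) coisotropic quantum subgroup of $A$ is a pair $(C,\pi)$ where $C$ is a coalgebra and a left (resp. right) $A$-module and $\pi:A\to C$ is a surjective linear map which is a coalgebra homomorphism and a left (resp. right) $A$-module homomorphism. A right corepresentation of a coalgebra $C$ on $V$ is a counital coassociative linear map $V\to V\otimes C$. Let $\Delta_G$ be the coproduct of $A_q(G)$ and $L=(\pi\otimes\mathrm{id})\circ\Delta_G:A_q(G)\to A_q(K)\otimes A_q(G)$. For a right corepresentation $\rho:V\to V\otimes A_q(K)$ define $$\mathrm{ind}_K^G(\rho)=\{F\in V\otimes A_q(G) : (\mathrm{id}\otimes L)(F)=(\rho\otimes\mathrm{id})(F)\},$$ regarded as a right corepresentation of $A_q(G)$ via $\mathrm{id}\otimes\Delta_G$. Both sides of the equality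 are subspaces of $V\otimes A_q(G)$ carrying the coaction $\mathrm{id}\otimes\Delta_G$. *)

theory Defs
  imports "HOL-Algebra.Module" "HOL-Algebra.AbelCoset"
begin

section \<open>Linear maps and tensor products of vector spaces\<close>

text \<open>
  Vector spaces over a field \<open>K\<close> are modules over \<open>K\<close> in the sense of \<open>HOL-Algebra\<close>; the fields
  \<open>mult\<close> and \<open>one\<close> of a module record are only meaningful for algebras. Maps are total functions
  of which only the values on the carrier matter.
\<close>

definition linear_map ::
  "('k, 'r) ring_scheme \<Rightarrow> ('k, 'v, 'm) module_scheme \<Rightarrow> ('k, 'w, 'n) module_scheme \<Rightarrow>
   ('v \<Rightarrow> 'w) \<Rightarrow> bool" where
  "linear_map K V W f \<longleftrightarrow>
     f \<in> carrier V \<rightarrow> carrier W \<and>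
     (\<forall>x\<in>carrier V. \<forall>y\<in>carrier V. f (x \<oplus>\<^bsub>V\<^esub> y) = f x \<oplus>\<^bsub>W\<^esub> f y) \<and>
     (\<forall>c\<in>carrier K. \<forall>x\<in>carrier V. f (c \<odot>\<^bsub>V\<^esub> x) = c \<odot>\<^bsub>W\<^esub> f x)"

definition ground_module :: "('k, 'r) ring_scheme \<Rightarrow> ('k, 'k) module" where
  "ground_module K =
     \<lparr>carrier = carrier K, monoid.mult = monoid.mult K, monoid.one = monoid.one K, ring.zero = ring.zero K, ring.add = ring.add K, smult = monoid.mult K\<rparr>"

definition bilinear_map ::
  "('k, 'r) ring_scheme \<Rightarrow> ('k, 'v, 'm) module_scheme \<Rightarrow> ('k, 'w, 'n) module_scheme \<Rightarrow>
   ('k, 'u, 'l) module_scheme \<Rightarrow> ('v \<Rightarrow> 'w \<Rightarrow> 'u) \<Rightarrow> bool" where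
  "bilinear_map K V W U \<beta> \<longleftrightarrow>
     (\<forall>v\<in>carrier V. linear_map K W U (\<beta> v)) \<and> (\<forall>w\<in>carrier W. linear_map K V U (\<lambda>v. \<beta> v w))"

definition free_pairs ::
  "('k, 'r) ring_scheme \<Rightarrow> ('k, 'v, 'm) module_scheme \<Rightarrow> ('k, 'w, 'n) module_scheme \<Rightarrow>
   ('k, 'v \<times> 'w \<Rightarrow> 'k) module" where
  "free_pairs K V W =
     \<lparr>carrier = {f. f \<in> UNIV \<rightarrow> carrier K \<and> finite {p. f p \<noteq> \<zero>\<^bsub>K\<^esub>} \<and>
                    {p. f p \<noteq> \<zero>\<^bsub>K\<^esub>} \<subseteq> carrier V \<times> carrier W},
      monoid.mult = undefined, monoid.one = undefined,
      ring.zero = (\<lambda>_. \<zero>\<^bsub>K\<^esub>), ring.add = (\<lambda>f g p. f p \<oplus>\<^bsub>K\<^esub> g p), smult = (\<lambda>c f p. c \<otimes>\<^bsub>K\<^esub> f p)\<rparr>"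

definition single :: "('k, 'r) ring_scheme \<Rightarrow> 'v \<Rightarrow> 'w \<Rightarrow> 'v \<times> 'w \<Rightarrow> 'k" where
  "single K v w = (\<lambda>p. if p = (v, w) then \<one>\<^bsub>K\<^esub> else \<zero>\<^bsub>K\<^esub>)"

definition bilinearity_relators ::
  "('k, 'r) ring_scheme \<Rightarrow> ('k, 'v, 'm) module_scheme \<Rightarrow> ('k, 'w, 'n) module_scheme \<Rightarrow>
   ('v \<times> 'w \<Rightarrow> 'k) set" where
  "bilinearity_relators K V W = (let F = free_pairs K V W in
     {single K (v \<oplus>\<^bsub>V\<^esub> v') w \<ominus>\<^bsub>F\<^esub> (single K v w \<oplus>\<^bsub>F\<^esub> single K v' w) |
        v v' w. v \<in> carrier V \<and> v' \<in> carrier V \<and> w \<in> carrier W} \<union>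
     {single K v (w \<oplus>\<^bsub>W\<^esub> w') \<ominus>\<^bsub>F\<^esub> (single K v w \<oplus>\<^bsub>F\<^esub> single K v w') |
        v w w'. v \<in> carrier V \<and> w \<in> carrier W \<and> w' \<in> carrier W} \<union>
     {single K (c \<odot>\<^bsub>V\<^esub> v) w \<ominus>\<^bsub>F\<^esub> c \<odot>\<^bsub>F\<^esub> single K v w |
        c v w. c \<in> carrier K \<and> v \<in> carrier V \<and> w \<in> carrier W} \<union>
     {single K v (c \<odot>\<^bsub>W\<^esub> w) \<ominus>\<^bsub>F\<^esub> c \<odot>\<^bsub>F\<^esub> single K v w |
        c v w. c \<in> carrier K \<and> v \<in> carrier V \<and> w \<in> carrier W})"

definition tensor_relations ::
  "('k, 'r) ring_scheme \<Rightarrow> ('k, 'v, 'm) module_scheme \<Rightarrow> ('k, 'w, 'n) module_scheme \<Rightarrow>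
   ('v \<times> 'w \<Rightarrow> 'k) set" where
  "tensor_relations K V W =
     \<Inter>{N. submodule N K (free_pairs K V W) \<and> bilinearity_relators K V W \<subseteq> N}"

text \<open>
  The tensor product over \<open>K\<close> is the quotient of the free vector space on pairs by the
  subspace spanned by the bilinearity relators, so its elements are cosets.
\<close>

definition tensor ::
  "('k, 'r) ring_scheme \<Rightarrow> ('k, 'v, 'm) module_scheme \<Rightarrow> ('k, 'w, 'n) module_scheme \<Rightarrow>
   ('k, ('v \<times> 'w \<Rightarrow> 'k) set) module" (infixl \<open>\<boxtimes>\<index>\<close> 70) where
  "tensor K V W = (let F = free_pairs K V W; N = tensor_relations K V W in
     \<lparr>carrier = a_rcosets\<^bsub>F\<^esub> N,
      monoid.mult = undefined, monoid.one = undefined,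
      ring.zero = N,
      ring.add = (\<lambda>s t. s <+>\<^bsub>F\<^esub> t),
      smult = (\<lambda>c t. \<Union>f\<in>t. N +>\<^bsub>F\<^esub> (c \<odot>\<^bsub>F\<^esub> f))\<rparr>)"

definition pure_tensor ::
  "('k, 'r) ring_scheme \<Rightarrow> ('k, 'v, 'm) module_scheme \<Rightarrow> ('k, 'w, 'n) module_scheme \<Rightarrow>
   'v \<Rightarrow> 'w \<Rightarrow> ('v \<times> 'w \<Rightarrow> 'k) set" where
  "pure_tensor K V W v w = tensor_relations K V W +>\<^bsub>free_pairs K V W\<^esub> single K v w"

text \<open>
  The linear map into \<open>U\<close> induced by a bilinear map \<open>\<beta>\<close>: it sends the class of \<open>\<Sum> f(v,w) (v,w)\<close>
  to \<open>\<Sum> f(v,w) \<beta>(v,w)\<close>. For bilinear \<open>\<beta>\<close> the chosen representative does not matter.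
\<close>

definition tensor_lift ::
  "('k, 'r) ring_scheme \<Rightarrow> ('k, 'u, 'm) module_scheme \<Rightarrow> ('v \<Rightarrow> 'w \<Rightarrow> 'u) \<Rightarrow>
   ('v \<times> 'w \<Rightarrow> 'k) set \<Rightarrow> 'u" where
  "tensor_lift K U \<beta> t = (let f = (SOME f. f \<in> t) in
     \<Oplus>\<^bsub>U\<^esub> p \<in> {p. f p \<noteq> \<zero>\<^bsub>K\<^esub>}. f p \<odot>\<^bsub>U\<^esub> \<beta> (fst p) (snd p))"

text \<open>\<open>tensor_map K V W f g\<close> is \<open>f \<otimes> g\<close> with codomain \<open>V \<boxtimes> W\<close>.\<close>

definition tensor_map ::
  "('k, 'r) ring_scheme \<Rightarrow> ('k, 'v, 'm) module_scheme \<Rightarrow> ('k, 'w, 'n) module_scheme \<Rightarrow>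
   ('x \<Rightarrow> 'v) \<Rightarrow> ('y \<Rightarrow> 'w) \<Rightarrow> ('x \<times> 'y \<Rightarrow> 'k) set \<Rightarrow> ('v \<times> 'w \<Rightarrow> 'k) set" where
  "tensor_map K V W f g = tensor_lift K (V \<boxtimes>\<^bsub>K\<^esub> W) (\<lambda>x y. pure_tensor K V W (f x) (g y))"

text \<open>The canonical isomorphism \<open>V \<otimes> (W \<otimes> U) \<rightarrow> (V \<otimes> W) \<otimes> U\<close>.\<close>

definition assoc_left ::
  "('k, 'r) ring_scheme \<Rightarrow> ('k, 'v, 'm) module_scheme \<Rightarrow> ('k, 'w, 'n) module_scheme \<Rightarrow>
   ('k, 'u, 'l) module_scheme \<Rightarrow>
   ('v \<times> ('w \<times> 'u \<Rightarrow> 'k) set \<Rightarrow> 'k) set \<Rightarrow> (('v \<times> 'w \<Rightarrow> 'k) set \<times> 'u \<Rightarrow> 'k) set" where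
  "assoc_left K V W U =
     tensor_lift K ((V \<boxtimes>\<^bsub>K\<^esub> W) \<boxtimes>\<^bsub>K\<^esub> U)
       (\<lambda>v. tensor_lift K ((V \<boxtimes>\<^bsub>K\<^esub> W) \<boxtimes>\<^bsub>K\<^esub> U)
              (\<lambda>w u. pure_tensor K (V \<boxtimes>\<^bsub>K\<^esub> W) U (pure_tensor K V W v w) u))"

definition tensor_algebra ::
  "('k, 'r) ring_scheme \<Rightarrow> ('k, 'a, 'm) module_scheme \<Rightarrow> ('k, 'b, 'n) module_scheme \<Rightarrow>
   ('k, ('a \<times> 'b \<Rightarrow> 'k) set) module" where
  "tensor_algebra K A B = (A \<boxtimes>\<^bsub>K\<^esub> B)
     \<lparr>monoid.mult := (\<lambda>s t. tensor_lift K (A \<boxtimes>\<^bsub>K\<^esub> B)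
                 (\<lambda>a b. tensor_lift K (A \<boxtimes>\<^bsub>K\<^esub> B)
                    (\<lambda>a' b'. pure_tensor K A B (a \<otimes>\<^bsub>A\<^esub> a') (b \<otimes>\<^bsub>B\<^esub> b')) t) s),
      monoid.one := pure_tensor K A B \<one>\<^bsub>A\<^esub> \<one>\<^bsub>B\<^esub>\<rparr>"


section \<open>Coalgebras, Hopf algebras and corepresentations\<close>

record ('k, 'c) coalgebra = "('k, 'c) module" +
  comult :: "'c \<Rightarrow> ('c \<times> 'c \<Rightarrow> 'k) set"
  counit :: "'c \<Rightarrow> 'k"

record ('k, 'a) hopf_algebra = "('k, 'a) coalgebra" +
  antipode :: "'a \<Rightarrow> 'a"

locale coalgebra = K: field K + module K C for K :: "('k, 'r) ring_scheme" and
    C :: "('k, 'c, 'm) coalgebra_scheme" +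
  assumes comult_linear: "linear_map K C (C \<boxtimes>\<^bsub>K\<^esub> C) (comult C)"
    and counit_linear: "linear_map K C (ground_module K) (counit C)"
    and coassoc: "c \<in> carrier C \<Longrightarrow>
      tensor_map K (C \<boxtimes>\<^bsub>K\<^esub> C) C (comult C) id (comult C c) =
      assoc_left K C C C (tensor_map K C (C \<boxtimes>\<^bsub>K\<^esub> C) id (comult C) (comult C c))"
    and counit_left: "c \<in> carrier C \<Longrightarrow>
      tensor_lift K C (\<lambda>x y. counit C x \<odot>\<^bsub>C\<^esub> y) (comult C c) = c"
    and counit_right: "c \<in> carrier C \<Longrightarrow>
      tensor_lift K C (\<lambda>x y. counit C y \<odot>\<^bsub>C\<^esub> x) (comult C c) = c"

definition coalgebra_hom ::
  "('k, 'r) ring_scheme \<Rightarrow> ('k, 'c, 'm) coalgebra_scheme \<Rightarrow> ('k, 'd, 'n) coalgebra_scheme \<Rightarrow>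
   ('c \<Rightarrow> 'd) \<Rightarrow> bool" where
  "coalgebra_hom K C D f \<longleftrightarrow>
     linear_map K C D f \<and>
     (\<forall>c\<in>carrier C. comult D (f c) = tensor_map K D D f f (comult C c)) \<and>
     (\<forall>c\<in>carrier C. counit D (f c) = counit C c)"

definition coalgebra_automorphism ::
  "('k, 'r) ring_scheme \<Rightarrow> ('k, 'c, 'm) coalgebra_scheme \<Rightarrow> ('c \<Rightarrow> 'c) \<Rightarrow> bool" where
  "coalgebra_automorphism K C f \<longleftrightarrow>
     coalgebra_hom K C C f \<and> bij_betw f (carrier C) (carrier C)"

locale hopf_algebra = coalgebra K A + A: ring A for K :: "('k, 'r) ring_scheme" and
    A :: "('k, 'a, 'm) hopf_algebra_scheme" +
  assumes smult_mult_left: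
      "\<lbrakk>c \<in> carrier K; x \<in> carrier A; y \<in> carrier A\<rbrakk> \<Longrightarrow>
       (c \<odot>\<^bsub>A\<^esub> x) \<otimes>\<^bsub>A\<^esub> y = c \<odot>\<^bsub>A\<^esub> (x \<otimes>\<^bsub>A\<^esub> y)"
    and smult_mult_right:
      "\<lbrakk>c \<in> carrier K; x \<in> carrier A; y \<in> carrier A\<rbrakk> \<Longrightarrow>
       x \<otimes>\<^bsub>A\<^esub> (c \<odot>\<^bsub>A\<^esub> y) = c \<odot>\<^bsub>A\<^esub> (x \<otimes>\<^bsub>A\<^esub> y)"
    and comult_hom: "comult A \<in> ring_hom A (tensor_algebra K A A)"
    and counit_hom: "counit A \<in> ring_hom A K"
    and antipode_linear: "linear_map K A A (antipode A)"
    and antipode_left: "a \<in> carrier A \<Longrightarrow>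
      tensor_lift K A (\<lambda>x y. antipode A x \<otimes>\<^bsub>A\<^esub> y) (comult A a) = counit A a \<odot>\<^bsub>A\<^esub> \<one>\<^bsub>A\<^esub>"
    and antipode_right: "a \<in> carrier A \<Longrightarrow>
      tensor_lift K A (\<lambda>x y. x \<otimes>\<^bsub>A\<^esub> antipode A y) (comult A a) = counit A a \<odot>\<^bsub>A\<^esub> \<one>\<^bsub>A\<^esub>"

text \<open>Compatibility with the antipode need not be required: bialgebra maps between Hopf algebras have it.\<close>

definition hopf_automorphism ::
  "('k, 'r) ring_scheme \<Rightarrow> ('k, 'a, 'm) hopf_algebra_scheme \<Rightarrow> ('a \<Rightarrow> 'a) \<Rightarrow> bool" where
  "hopf_automorphism K A \<alpha> \<longleftrightarrow>
     coalgebra_hom K A A \<alpha> \<and> \<alpha> \<in> ring_hom A A \<and> bij_betw \<alpha> (carrier A) (carrier A)"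

definition left_action ::
  "('k, 'r) ring_scheme \<Rightarrow> ('k, 'a, 'm) module_scheme \<Rightarrow> ('k, 'c, 'n) module_scheme \<Rightarrow>
   ('a \<Rightarrow> 'c \<Rightarrow> 'c) \<Rightarrow> bool" where
  "left_action K A C act \<longleftrightarrow>
     bilinear_map K A C C act \<and>
     (\<forall>a\<in>carrier A. \<forall>b\<in>carrier A. \<forall>c\<in>carrier C. act (a \<otimes>\<^bsub>A\<^esub> b) c = act a (act b c)) \<and>
     (\<forall>c\<in>carrier C. act \<one>\<^bsub>A\<^esub> c = c)"

definition right_action ::
  "('k, 'r) ring_scheme \<Rightarrow> ('k, 'a, 'm) module_scheme \<Rightarrow> ('k, 'c, 'n) module_scheme \<Rightarrow>
   ('c \<Rightarrow> 'a \<Rightarrow> 'c) \<Rightarrow> bool" where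
  "right_action K A C act \<longleftrightarrow>
     bilinear_map K C A C act \<and>
     (\<forall>c\<in>carrier C. \<forall>a\<in>carrier A. \<forall>b\<in>carrier A. act c (a \<otimes>\<^bsub>A\<^esub> b) = act (act c a) b) \<and>
     (\<forall>c\<in>carrier C. act c \<one>\<^bsub>A\<^esub> = c)"

definition left_coisotropic_quantum_subgroup ::
  "('k, 'r) ring_scheme \<Rightarrow> ('k, 'a, 'm) hopf_algebra_scheme \<Rightarrow> ('k, 'c, 'n) coalgebra_scheme \<Rightarrow>
   ('a \<Rightarrow> 'c) \<Rightarrow> bool" where
  "left_coisotropic_quantum_subgroup K A C \<pi> \<longleftrightarrow>
     coalgebra K C \<and> coalgebra_hom K A C \<pi> \<and> \<pi> ` carrier A = carrier C \<and>
     (\<exists>act. left_action K A C act \<and>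
        (\<forall>a\<in>carrier A. \<forall>b\<in>carrier A. \<pi> (a \<otimes>\<^bsub>A\<^esub> b) = act a (\<pi> b)))"

definition right_coisotropic_quantum_subgroup ::
  "('k, 'r) ring_scheme \<Rightarrow> ('k, 'a, 'm) hopf_algebra_scheme \<Rightarrow> ('k, 'c, 'n) coalgebra_scheme \<Rightarrow>
   ('a \<Rightarrow> 'c) \<Rightarrow> bool" where
  "right_coisotropic_quantum_subgroup K A C \<pi> \<longleftrightarrow>
     coalgebra K C \<and> coalgebra_hom K A C \<pi> \<and> \<pi> ` carrier A = carrier C \<and>
     (\<exists>act. right_action K A C act \<and>
        (\<forall>a\<in>carrier A. \<forall>b\<in>carrier A. \<pi> (a \<otimes>\<^bsub>A\<^esub> b) = act (\<pi> a) b))"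

definition right_corepresentation ::
  "('k, 'r) ring_scheme \<Rightarrow> ('k, 'c, 'm) coalgebra_scheme \<Rightarrow> ('k, 'v, 'n) module_scheme \<Rightarrow>
   ('v \<Rightarrow> ('v \<times> 'c \<Rightarrow> 'k) set) \<Rightarrow> bool" where
  "right_corepresentation K C V \<rho> \<longleftrightarrow>
     module K V \<and>
     linear_map K V (V \<boxtimes>\<^bsub>K\<^esub> C) \<rho> \<and>
     (\<forall>v\<in>carrier V. tensor_map K (V \<boxtimes>\<^bsub>K\<^esub> C) C \<rho> id (\<rho> v) =
        assoc_left K V C C (tensor_map K V (C \<boxtimes>\<^bsub>K\<^esub> C) id (comult C) (\<rho> v))) \<and>
     (\<forall>v\<in>carrier V. tensor_lift K V (\<lambda>x c. counit C c \<odot>\<^bsub>V\<^esub> x) (\<rho> v) = v)"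

definition equivalent_corepresentations ::
  "('k, 'r) ring_scheme \<Rightarrow> ('k, 'c, 'm) coalgebra_scheme \<Rightarrow>
   ('k, 'v, 'n) module_scheme \<Rightarrow> ('v \<Rightarrow> ('v \<times> 'c \<Rightarrow> 'k) set) \<Rightarrow>
   ('k, 'w, 'l) module_scheme \<Rightarrow> ('w \<Rightarrow> ('w \<times> 'c \<Rightarrow> 'k) set) \<Rightarrow> bool" where
  "equivalent_corepresentations K C V \<rho> W \<sigma> \<longleftrightarrow>
     right_corepresentation K C V \<rho> \<and> right_corepresentation K C W \<sigma> \<and>
     (\<exists>T. linear_map K V W T \<and> bij_betw T (carrier V) (carrier W) \<and>
        (\<forall>v\<in>carrier V. tensor_map K W C T id (\<rho> v) = \<sigma> (T v)))"


section \<open>Induced corepresentations\<close>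

definition L_coaction ::
  "('k, 'r) ring_scheme \<Rightarrow> ('k, 'a, 'm) hopf_algebra_scheme \<Rightarrow> ('k, 'c, 'n) coalgebra_scheme \<Rightarrow>
   ('a \<Rightarrow> 'c) \<Rightarrow> 'a \<Rightarrow> ('c \<times> 'a \<Rightarrow> 'k) set" where
  "L_coaction K A C \<pi> a = tensor_map K C A \<pi> id (comult A a)"

text \<open>
  \<open>(id \<otimes> L)(F)\<close> lies in \<open>V \<otimes> (C \<otimes> A)\<close> and \<open>(\<rho> \<otimes> id)(F)\<close> in \<open>(V \<otimes> C) \<otimes> A\<close>; they are compared
  along the canonical isomorphism.
\<close>

definition ind ::
  "('k, 'r) ring_scheme \<Rightarrow> ('k, 'a, 'm) hopf_algebra_scheme \<Rightarrow> ('k, 'c, 'n) coalgebra_scheme \<Rightarrow>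
   ('a \<Rightarrow> 'c) \<Rightarrow> ('k, 'v, 'l) module_scheme \<Rightarrow> ('v \<Rightarrow> ('v \<times> 'c \<Rightarrow> 'k) set) \<Rightarrow>
   ('v \<times> 'a \<Rightarrow> 'k) set set" where
  "ind K A C \<pi> V \<rho> = {F \<in> carrier (V \<boxtimes>\<^bsub>K\<^esub> A).
     assoc_left K V C A (tensor_map K V (C \<boxtimes>\<^bsub>K\<^esub> A) id (L_coaction K A C \<pi>) F) =
     tensor_map K (V \<boxtimes>\<^bsub>K\<^esub> C) A \<rho> id F}"

text \<open>The map \<open>id \<otimes> \<Delta>\<^sub>G : V \<otimes> A \<rightarrow> (V \<otimes> A) \<otimes> A\<close>.\<close>

definition id_tensor_comult ::
  "('k, 'r) ring_scheme \<Rightarrow> ('k, 'a, 'm) hopf_algebra_scheme \<Rightarrow> ('k, 'v, 'n) module_scheme \<Rightarrow>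
   ('v \<times> 'a \<Rightarrow> 'k) set \<Rightarrow> (('v \<times> 'a \<Rightarrow> 'k) set \<times> 'a \<Rightarrow> 'k) set" where
  "id_tensor_comult K A V F = assoc_left K V A A (tensor_map K V (A \<boxtimes>\<^bsub>K\<^esub> A) id (comult A) F)"

abbreviation subspace_module ::
  "('k, 'v, 'm) module_scheme \<Rightarrow> 'v set \<Rightarrow> ('k, 'v, 'm) module_scheme" where
  "subspace_module M W \<equiv> M\<lparr>carrier := W\<rparr>"

text \<open>
  Restriction of a coaction \<open>\<delta>\<close> on \<open>M\<close> to a subspace \<open>W\<close> with \<open>\<delta>(W) \<subseteq> W \<otimes> C\<close>. The elements of
  \<open>W \<otimes> C\<close> and \<open>M \<otimes> C\<close> are different cosets, so the inclusion \<open>W \<otimes> C \<rightarrow> M \<otimes> C\<close>, which is injective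
  over a field, has to be made explicit.
\<close>

definition restricted_coaction ::
  "('k, 'r) ring_scheme \<Rightarrow> ('k, 'c, 'm) coalgebra_scheme \<Rightarrow> ('k, 'v, 'n) module_scheme \<Rightarrow>
   'v set \<Rightarrow> ('v \<Rightarrow> ('v \<times> 'c \<Rightarrow> 'k) set) \<Rightarrow> 'v \<Rightarrow> ('v \<times> 'c \<Rightarrow> 'k) set" where
  "restricted_coaction K C M W \<delta> w =
     (THE y. y \<in> carrier (subspace_module M W \<boxtimes>\<^bsub>K\<^esub> C) \<and> tensor_map K M C id id y = \<delta> w)"

end

theory Submission
  imports Defs
begin

text \<open>
  Write \<open>\<Delta>\<close> for the coproduct of \<open>A\<close> and \<open>L = (\<pi> \<otimes> id) \<Delta>\<close>. Up to the associator,
  \<open>ind \<rho>\<close> is the equalizer of the two linear maps \<open>id \<otimes> L\<close> and \<open>\<rho> \<otimes> id\<close> from \<open>V \<otimes> A\<close> to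
  \<open>(V \<otimes> C) \<otimes> A\<close>.

  The equality of the two subspaces is naturality. Since \<open>\<alpha>\<close> is a coalgebra map and
  \<open>\<alpha>' \<pi> = \<pi> \<alpha>\<close>, one has \<open>L \<alpha> = (\<alpha>' \<otimes> \<alpha>) L\<close>. Precomposing the two maps that define
  \<open>ind ((id \<otimes> \<alpha>') \<rho>)\<close> with \<open>id \<otimes> \<alpha>\<close> therefore gives the two maps that define \<open>ind \<rho>\<close>,
  followed by the same injective map \<open>(id \<otimes> \<alpha>') \<otimes> \<alpha>\<close>; so \<open>(id \<otimes> \<alpha>) F\<close> lies in the first
  space exactly when \<open>F\<close> lies in the second, and \<open>id \<otimes> \<alpha>\<close> is bijective on \<open>V \<otimes> A\<close>
  (\<open>ind_automorphism\<close>). The equivalence of corepresentations is then realised by the identity.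

  What remains is that \<open>id \<otimes> \<Delta>\<close> really restricts to a corepresentation on such a space
  (\<open>ind_corepresentation\<close>), and here the field matters. Coassociativity shows that
  \<open>id \<otimes> L\<close> and \<open>\<rho> \<otimes> id\<close> both intertwine the coactions \<open>id \<otimes> \<Delta>\<close> of their source and
  target. Hence if \<open>F\<close> lies in the equalizer, the images of \<open>(id \<otimes> \<Delta>) F\<close> under the two maps
  tensored with \<open>id\<close> agree. Because tensoring over a field preserves equalizers
  (\<open>tensor_equalizer\<close>), \<open>(id \<otimes> \<Delta>) F\<close> then comes from \<open>ind \<rho> \<otimes> A\<close>, and it does so in only one
  way because tensoring also preserves injectivity (\<open>tensor_map_inj_on\<close>). All axioms of a
  corepresentation descend along this injection (\<open>right_corepresentation_restrict\<close>).

  Identities between maps out of tensor products are checked on pure tensors (\<open>tensor_ext\<close>);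
  where a factor such as \<open>\<Delta> a\<close> is not pure, it is replaced by an arbitrary tensor first.
\<close>

section \<open>Linear maps\<close>

lemma module_cring: "module K V \<Longrightarrow> cring K"
  by (simp add: module_def)

lemma linear_mapI:
  assumes "\<And>x. x \<in> carrier V \<Longrightarrow> f x \<in> carrier W"
    and "\<And>x y. \<lbrakk>x \<in> carrier V; y \<in> carrier V\<rbrakk> \<Longrightarrow> f (x \<oplus>\<^bsub>V\<^esub> y) = f x \<oplus>\<^bsub>W\<^esub> f y"
    and "\<And>c x. \<lbrakk>c \<in> carrier K; x \<in> carrier V\<rbrakk> \<Longrightarrow> f (c \<odot>\<^bsub>V\<^esub> x) = c \<odot>\<^bsub>W\<^esub> f x"
  shows "linear_map K V W f"
  using assms by (auto simp: linear_map_def)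

lemma linear_map_closed: "linear_map K V W f \<Longrightarrow> x \<in> carrier V \<Longrightarrow> f x \<in> carrier W"
  and linear_map_add: "linear_map K V W f \<Longrightarrow> x \<in> carrier V \<Longrightarrow> y \<in> carrier V \<Longrightarrow>
    f (x \<oplus>\<^bsub>V\<^esub> y) = f x \<oplus>\<^bsub>W\<^esub> f y"
  and linear_map_smult: "linear_map K V W f \<Longrightarrow> c \<in> carrier K \<Longrightarrow> x \<in> carrier V \<Longrightarrow>
    f (c \<odot>\<^bsub>V\<^esub> x) = c \<odot>\<^bsub>W\<^esub> f x"
  by (auto simp: linear_map_def)

lemma linear_map_id: "linear_map K V V id"
  by (auto simp: linear_map_def)

lemma linear_map_comp:
  "linear_map K V W f \<Longrightarrow> linear_map K W U g \<Longrightarrow> linear_map K V U (\<lambda>x. g (f x))"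
  by (auto simp: linear_map_def Pi_iff)

lemma linear_map_zero:
  assumes "module K V" "module K W" "linear_map K V W f"
  shows "f \<zero>\<^bsub>V\<^esub> = \<zero>\<^bsub>W\<^esub>"
proof -
  interpret V: module K V by fact
  interpret W: module K W by fact
  have "f (\<zero>\<^bsub>K\<^esub> \<odot>\<^bsub>V\<^esub> \<zero>\<^bsub>V\<^esub>) = \<zero>\<^bsub>K\<^esub> \<odot>\<^bsub>W\<^esub> f \<zero>\<^bsub>V\<^esub>"
    by (rule linear_map_smult[OF assms(3)]) auto
  then show ?thesis
    using linear_map_closed[OF assms(3)] by simp
qed

lemma linear_map_a_inv:
  assumes "module K V" "module K W" "linear_map K V W f" "x \<in> carrier V"
  shows "f (\<ominus>\<^bsub>V\<^esub> x) = \<ominus>\<^bsub>W\<^esub> f x"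
proof -
  interpret V: module K V by fact
  interpret W: module K W by fact
  note c = linear_map_closed[OF assms(3)]
  have "f (\<ominus>\<^bsub>V\<^esub> x) \<oplus>\<^bsub>W\<^esub> f x = f (\<ominus>\<^bsub>V\<^esub> x \<oplus>\<^bsub>V\<^esub> x)"
    using assms by (simp add: linear_map_add)
  also have "\<dots> = \<zero>\<^bsub>W\<^esub>"
    using assms by (simp add: V.l_neg linear_map_zero)
  finally show ?thesis
    using assms(4) c by (simp add: W.minus_equality)
qed

lemma linear_map_a_minus:
  assumes "module K V" "module K W" "linear_map K V W f" "x \<in> carrier V" "y \<in> carrier V"
  shows "f (x \<ominus>\<^bsub>V\<^esub> y) = f x \<ominus>\<^bsub>W\<^esub> f y"
proof -
  interpret V: module K V by fact
  interpret W: module K W by fact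
  show ?thesis
    using assms linear_map_closed[OF assms(3)]
    by (simp add: a_minus_def linear_map_add linear_map_a_inv)
qed

lemma equalizer_submodule:
  assumes "module K V" "module K W" "linear_map K V W f" "linear_map K V W g"
  shows "submodule {x \<in> carrier V. f x = g x} K V"
proof -
  interpret V: module K V by fact
  interpret W: module K W by fact
  show ?thesis
    by (rule V.submoduleI)
      (auto simp: assms linear_map_zero[OF assms(1-3)] linear_map_zero[OF assms(1,2,4)]
        linear_map_a_inv[OF assms(1-3)] linear_map_a_inv[OF assms(1,2,4)]
        linear_map_add[OF assms(3)] linear_map_add[OF assms(4)]
        linear_map_smult[OF assms(3)] linear_map_smult[OF assms(4)])
qed

lemma linear_map_const_zero:
  assumes "module K V" "module K W"
  shows "linear_map K V W (\<lambda>_. \<zero>\<^bsub>W\<^esub>)"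
proof -
  interpret V: module K V by fact
  interpret W: module K W by fact
  show ?thesis by (rule linear_mapI) auto
qed

lemma linear_map_ident: "linear_map K V V (\<lambda>x. x)"
  by (auto simp: linear_map_def)

lemma linear_map_sum:
  assumes "module K W" "linear_map K V W f" "linear_map K V W g"
  shows "linear_map K V W (\<lambda>x. f x \<oplus>\<^bsub>W\<^esub> g x)"
proof -
  interpret W: module K W by fact
  show ?thesis
    by (rule linear_mapI)
      (auto simp: linear_map_closed[OF assms(2)] linear_map_closed[OF assms(3)]
        linear_map_add[OF assms(2)] linear_map_add[OF assms(3)]
        linear_map_smult[OF assms(2)] linear_map_smult[OF assms(3)] W.smult_r_distr W.M.a_ac)
qed

lemma linear_map_scale:
  assumes "module K W" "linear_map K V W f" "c \<in> carrier K"
  shows "linear_map K V W (\<lambda>x. c \<odot>\<^bsub>W\<^esub> f x)"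
proof -
  interpret W: module K W by fact
  show ?thesis
    using assms(3)
    by (intro linear_mapI)
      (auto simp: linear_map_closed[OF assms(2)] linear_map_add[OF assms(2)]
        linear_map_smult[OF assms(2)] W.smult_r_distr W.smult_assoc1[symmetric] W.R.m_comm)
qed

lemma linear_map_cong:
  assumes "module K V" "linear_map K V W f" "\<And>x. x \<in> carrier V \<Longrightarrow> f x = g x"
  shows "linear_map K V W g"
proof -
  interpret V: module K V by fact
  have "linear_map K V W f \<longleftrightarrow> linear_map K V W g"
    unfolding linear_map_def using assms(3) by (auto simp: Pi_iff)
  then show ?thesis using assms(2) by blast
qed

lemma linear_map_inv_into:
  assumes "module K V" "linear_map K V W f" "bij_betw f (carrier V) (carrier W)"
  shows "linear_map K W V (inv_into (carrier V) f)"
proof -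
  interpret V: module K V by fact
  note inv = bij_betw_inv_into_left[OF assms(3)] bij_betw_inv_into_right[OF assms(3)]
  have c: "inv_into (carrier V) f y \<in> carrier V" if "y \<in> carrier W" for y
    using bij_betwE[OF bij_betw_inv_into[OF assms(3)]] that by blast
  show ?thesis
  proof (rule linear_mapI)
    fix x y assume x: "x \<in> carrier W" and y: "y \<in> carrier W"
    let ?g = "inv_into (carrier V) f"
    have "x \<oplus>\<^bsub>W\<^esub> y = f (?g x \<oplus>\<^bsub>V\<^esub> ?g y)"
      using c[OF x] c[OF y] x y by (simp add: linear_map_add[OF assms(2)] inv)
    then show "?g (x \<oplus>\<^bsub>W\<^esub> y) = ?g x \<oplus>\<^bsub>V\<^esub> ?g y"
      using c[OF x] c[OF y] by (simp add: inv)
  next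
    fix k x assume k: "k \<in> carrier K" and x: "x \<in> carrier W"
    let ?g = "inv_into (carrier V) f"
    have "k \<odot>\<^bsub>W\<^esub> x = f (k \<odot>\<^bsub>V\<^esub> ?g x)"
      using c[OF x] x k by (simp add: linear_map_smult[OF assms(2)] inv)
    then show "?g (k \<odot>\<^bsub>W\<^esub> x) = k \<odot>\<^bsub>V\<^esub> ?g x"
      using c[OF x] k by (simp add: inv)
  qed (rule c)
qed

lemma linear_map_image_zero:
  assumes "module K V" "module K W" "linear_map K V W f"
  shows "\<zero>\<^bsub>W\<^esub> \<in> f ` carrier V"
proof -
  interpret V: module K V by fact
  show ?thesis
    by (metis V.M.zero_closed assms image_eqI linear_map_zero)
qed

lemma linear_map_image_add:
  assumes "module K V" "linear_map K V W f" "s \<in> f ` carrier V" "t \<in> f ` carrier V"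
  shows "s \<oplus>\<^bsub>W\<^esub> t \<in> f ` carrier V"
proof -
  interpret V: module K V by fact
  obtain x y where "x \<in> carrier V" "s = f x" "y \<in> carrier V" "t = f y"
    using assms(3,4) by blast
  then show ?thesis
    by (intro image_eqI[of _ _ "x \<oplus>\<^bsub>V\<^esub> y"]) (simp_all add: linear_map_add[OF assms(2)])
qed

lemma submodule_linear_id: "submodule W K M \<Longrightarrow> module K M \<Longrightarrow> linear_map K (subspace_module M W) M id"
  by (rule linear_mapI) (auto dest: module.submoduleE(1))

lemma bilinear_mapI:
  assumes "\<And>v. v \<in> carrier V \<Longrightarrow> linear_map K W U (\<beta> v)"
    and "\<And>w. w \<in> carrier W \<Longrightarrow> linear_map K V U (\<lambda>v. \<beta> v w)"
  shows "bilinear_map K V W U \<beta>"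
  using assms by (simp add: bilinear_map_def)

lemma bilinear_map_right: "bilinear_map K V W U \<beta> \<Longrightarrow> v \<in> carrier V \<Longrightarrow> linear_map K W U (\<beta> v)"
  and bilinear_map_left: "bilinear_map K V W U \<beta> \<Longrightarrow> w \<in> carrier W \<Longrightarrow> linear_map K V U (\<lambda>v. \<beta> v w)"
  by (auto simp: bilinear_map_def)

lemma bilinear_map_closed:
  "bilinear_map K V W U \<beta> \<Longrightarrow> v \<in> carrier V \<Longrightarrow> w \<in> carrier W \<Longrightarrow> \<beta> v w \<in> carrier U"
  by (meson bilinear_map_right linear_map_closed)

lemma bilinear_scale_right:
  assumes "module K M" "module K A" "linear_map K A (ground_module K) \<phi>"
  shows "bilinear_map K M A M (\<lambda>m a. \<phi> a \<odot>\<^bsub>M\<^esub> m)"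
proof -
  interpret M: module K M by fact
  have \<phi>: "x \<in> carrier A \<Longrightarrow> \<phi> x \<in> carrier K" for x
    using linear_map_closed[OF assms(3)] by (auto simp: ground_module_def)
  show ?thesis
  proof (intro bilinear_mapI)
    fix m assume "m \<in> carrier M"
    then show "linear_map K A M (\<lambda>a. \<phi> a \<odot>\<^bsub>M\<^esub> m)"
      using \<phi> by (intro linear_mapI)
        (auto simp: linear_map_add[OF assms(3)] linear_map_smult[OF assms(3)] ground_module_def
          M.smult_l_distr M.smult_assoc1)
  next
    fix a assume "a \<in> carrier A"
    then show "linear_map K M M (\<lambda>m. \<phi> a \<odot>\<^bsub>M\<^esub> m)"
      using \<phi> by (intro linear_map_scale assms linear_map_ident) auto
  qed
qed

section \<open>The free module on pairs\<close>

lemma free_pairs_module: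
  fixes K :: "('k, 'r) ring_scheme" and V :: "('k, 'v, 'm) module_scheme"
    and W :: "('k, 'w, 'n) module_scheme"
  assumes "cring K"
  shows "module K (free_pairs K V W)"
proof -
  interpret K: cring K by fact
  have supp_add: "{p. f p \<oplus>\<^bsub>K\<^esub> g p \<noteq> \<zero>\<^bsub>K\<^esub>} \<subseteq> {p. f p \<noteq> \<zero>\<^bsub>K\<^esub>} \<union> {p. g p \<noteq> \<zero>\<^bsub>K\<^esub>}" for f g :: "'v \<times> 'w \<Rightarrow> 'k"
    by auto
  have supp_smult: "{p. c \<otimes>\<^bsub>K\<^esub> f p \<noteq> \<zero>\<^bsub>K\<^esub>} \<subseteq> {p. f p \<noteq> \<zero>\<^bsub>K\<^esub>}" if "c \<in> carrier K" for c and f :: "'v \<times> 'w \<Rightarrow> 'k"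
    using that by auto
  have supp_inv: "{p. \<ominus>\<^bsub>K\<^esub> f p \<noteq> \<zero>\<^bsub>K\<^esub>} \<subseteq> {p. f p \<noteq> \<zero>\<^bsub>K\<^esub>}" for f :: "'v \<times> 'w \<Rightarrow> 'k"
    by auto
  show ?thesis
  proof (rule moduleI)
    show "abelian_group (free_pairs K V W)"
    proof (rule abelian_groupI)
      fix f assume f: "f \<in> carrier (free_pairs K V W)"
      show "\<exists>y\<in>carrier (free_pairs K V W). y \<oplus>\<^bsub>free_pairs K V W\<^esub> f = \<zero>\<^bsub>free_pairs K V W\<^esub>"
        using f finite_subset[OF supp_inv[of f]] subset_trans[OF supp_inv[of f]]
        by (intro bexI[of _ "\<lambda>p. \<ominus>\<^bsub>K\<^esub> f p"]) (auto simp: free_pairs_def Pi_iff K.l_neg)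
    next
      fix f g assume f: "f \<in> carrier (free_pairs K V W)" and g: "g \<in> carrier (free_pairs K V W)"
      have "finite {p. f p \<oplus>\<^bsub>K\<^esub> g p \<noteq> \<zero>\<^bsub>K\<^esub>}"
        using finite_subset[OF supp_add] f g by (auto simp: free_pairs_def)
      then show "f \<oplus>\<^bsub>free_pairs K V W\<^esub> g \<in> carrier (free_pairs K V W)"
        using f g subset_trans[OF supp_add[of f g]] by (auto simp: free_pairs_def Pi_iff)
    qed (auto simp: free_pairs_def Pi_iff K.a_ac)
  next
    fix c f assume c: "c \<in> carrier K" and f: "f \<in> carrier (free_pairs K V W)"
    show "c \<odot>\<^bsub>free_pairs K V W\<^esub> f \<in> carrier (free_pairs K V W)"
      using c f finite_subset[OF supp_smult[OF c, of f]] subset_trans[OF supp_smult[OF c, of f]]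
      by (auto simp: free_pairs_def Pi_iff)
  qed (use assms in \<open>auto simp: free_pairs_def Pi_iff K.l_distr K.r_distr K.m_assoc\<close>)
qed

lemma single_closed:
  "cring K \<Longrightarrow> v \<in> carrier V \<Longrightarrow> w \<in> carrier W \<Longrightarrow> single K v w \<in> carrier (free_pairs K V W)"
proof -
  assume "cring K" and vw: "v \<in> carrier V" "w \<in> carrier W"
  interpret K: cring K by fact
  have "{p. single K v w p \<noteq> \<zero>\<^bsub>K\<^esub>} \<subseteq> {(v, w)}" by (auto simp: single_def)
  moreover have "finite {p. single K v w p \<noteq> \<zero>\<^bsub>K\<^esub>}"
    by (rule finite_subset[OF calculation]) simp
  ultimately show ?thesis
    using vw by (auto simp: free_pairs_def single_def)
qed

lemma bilinearity_relators_closed: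
  assumes "module K V" "module K W"
  shows "bilinearity_relators K V W \<subseteq> carrier (free_pairs K V W)"
proof -
  interpret V: module K V by fact
  interpret W: module K W by fact
  interpret F: module K "free_pairs K V W"
    using assms by (intro free_pairs_module module_cring)
  show ?thesis
    by (auto simp: bilinearity_relators_def Let_def single_closed[OF V.R.is_cring]
        intro!: F.M.minus_closed F.M.add.m_closed F.smult_closed)
qed

lemma tensor_relations_submodule:
  assumes "module K V" "module K W"
  shows "submodule (tensor_relations K V W) K (free_pairs K V W)"
proof -
  interpret F: module K "free_pairs K V W"
    using assms by (intro free_pairs_module module_cring)
  have c: "carrier (free_pairs K V W)
      \<in> {N. submodule N K (free_pairs K V W) \<and> bilinearity_relators K V W \<subseteq> N}"
    using F.carrier_is_submodule bilinearity_relators_closed[OF assms] by simp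
  have sub: "N \<subseteq> carrier (free_pairs K V W)" "\<zero>\<^bsub>free_pairs K V W\<^esub> \<in> N"
    if "submodule N K (free_pairs K V W)" for N
    using F.submoduleE(1)[OF that] subgroup.one_closed[OF submodule.axioms(1)[OF that]] by auto
  show ?thesis
    unfolding tensor_relations_def
    by (rule F.submoduleI)
      (use c sub in \<open>auto intro: F.submoduleE(3,4,5) simp del: partial_object.simps\<close>)
qed

lemma relators_in_tensor_relations: "bilinearity_relators K V W \<subseteq> tensor_relations K V W"
  by (auto simp: tensor_relations_def)

lemma tensor_relations_least:
  "submodule N K (free_pairs K V W) \<Longrightarrow> bilinearity_relators K V W \<subseteq> N \<Longrightarrow> tensor_relations K V W \<subseteq> N"
  by (auto simp: tensor_relations_def)

section \<open>The tensor product is a module spanned by pure tensors\<close>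

text \<open>
  The projection from the free module onto the tensor product. On classes all operations of
  \<open>V \<otimes> W\<close> can be computed with representatives.
\<close>

definition tensor_class ::
  "('k, 'r) ring_scheme \<Rightarrow> ('k, 'v, 'm) module_scheme \<Rightarrow> ('k, 'w, 'n) module_scheme \<Rightarrow>
   ('v \<times> 'w \<Rightarrow> 'k) \<Rightarrow> ('v \<times> 'w \<Rightarrow> 'k) set" where
  "tensor_class K V W f = tensor_relations K V W +>\<^bsub>free_pairs K V W\<^esub> f"

lemma tensor_relations_abelian_subgroup:
  assumes "module K V" "module K W"
  shows "abelian_subgroup (tensor_relations K V W) (free_pairs K V W)"
proof -
  interpret F: module K "free_pairs K V W"
    using assms by (intro free_pairs_module module_cring)
  show ?thesis
    using tensor_relations_submodule[OF assms]
    by (intro abelian_subgroupI3 additive_subgroupI F.M.abelian_group_axioms)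
      (simp add: submodule_def)
qed

lemma carrier_tensor: "carrier (V \<boxtimes>\<^bsub>K\<^esub> W) = tensor_class K V W ` carrier (free_pairs K V W)"
  by (auto simp: tensor_def Let_def tensor_class_def A_RCOSETS_def')

lemma tensor_class_closed:
  "f \<in> carrier (free_pairs K V W) \<Longrightarrow> tensor_class K V W f \<in> carrier (V \<boxtimes>\<^bsub>K\<^esub> W)"
  by (simp add: carrier_tensor)

lemma tensor_class_add:
  assumes "module K V" "module K W"
    "f \<in> carrier (free_pairs K V W)" "g \<in> carrier (free_pairs K V W)"
  shows "tensor_class K V W f \<oplus>\<^bsub>V \<boxtimes>\<^bsub>K\<^esub> W\<^esub> tensor_class K V W g
    = tensor_class K V W (f \<oplus>\<^bsub>free_pairs K V W\<^esub> g)"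
proof -
  interpret N: abelian_subgroup "tensor_relations K V W" "free_pairs K V W"
    using assms by (intro tensor_relations_abelian_subgroup)
  show ?thesis
    using N.a_rcos_sum[OF assms(3,4)] by (simp add: tensor_def Let_def tensor_class_def)
qed

lemma tensor_class_zero:
  assumes "module K V" "module K W"
  shows "tensor_class K V W \<zero>\<^bsub>free_pairs K V W\<^esub> = \<zero>\<^bsub>V \<boxtimes>\<^bsub>K\<^esub> W\<^esub>"
proof -
  interpret N: abelian_subgroup "tensor_relations K V W" "free_pairs K V W"
    using assms by (intro tensor_relations_abelian_subgroup)
  show ?thesis
    by (simp add: tensor_def Let_def tensor_class_def N.a_subset)
qed

lemma tensor_class_eqI:
  assumes "module K V" "module K W"
    "f \<in> carrier (free_pairs K V W)" "g \<in> carrier (free_pairs K V W)"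
    "f \<ominus>\<^bsub>free_pairs K V W\<^esub> g \<in> tensor_relations K V W"
  shows "tensor_class K V W f = tensor_class K V W g"
proof -
  interpret N: abelian_subgroup "tensor_relations K V W" "free_pairs K V W"
    using assms by (intro tensor_relations_abelian_subgroup)
  have "f \<in> tensor_relations K V W +>\<^bsub>free_pairs K V W\<^esub> g"
    using assms by (simp add: N.a_rcos_module a_minus_def)
  then show ?thesis
    using N.a_repr_independence'[of f g] assms by (simp add: tensor_class_def)
qed

lemma mem_tensor_class:
  assumes "module K V" "module K W" "f \<in> carrier (free_pairs K V W)" "g \<in> tensor_class K V W f"
  obtains h where "h \<in> tensor_relations K V W" "g = h \<oplus>\<^bsub>free_pairs K V W\<^esub> f"
  using assms(4) by (auto simp: tensor_class_def a_r_coset_def')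

lemma tensor_class_self:
  assumes "module K V" "module K W" "f \<in> carrier (free_pairs K V W)"
  shows "f \<in> tensor_class K V W f"
proof -
  interpret N: abelian_subgroup "tensor_relations K V W" "free_pairs K V W"
    using assms by (intro tensor_relations_abelian_subgroup)
  show ?thesis using assms by (simp add: tensor_class_def N.a_rcos_self)
qed

text \<open>
  Multiplying a coset elementwise by \<open>c\<close> need not give a whole coset (take \<open>c = 0\<close>), which is why
  the scalar multiplication unites the cosets of all \<open>c f\<close>; these coincide because the relations
  are closed under scalars.
\<close>

lemma tensor_class_smult:
  assumes "module K V" "module K W" "c \<in> carrier K" "f \<in> carrier (free_pairs K V W)"
  shows "c \<odot>\<^bsub>V \<boxtimes>\<^bsub>K\<^esub> W\<^esub> tensor_class K V W f = tensor_class K V W (c \<odot>\<^bsub>free_pairs K V W\<^esub> f)"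
proof -
  interpret F: module K "free_pairs K V W"
    using assms by (intro free_pairs_module module_cring)
  interpret N: abelian_subgroup "tensor_relations K V W" "free_pairs K V W"
    using assms by (intro tensor_relations_abelian_subgroup)
  have "tensor_class K V W (c \<odot>\<^bsub>free_pairs K V W\<^esub> g) = tensor_class K V W (c \<odot>\<^bsub>free_pairs K V W\<^esub> f)"
    if g: "g \<in> tensor_class K V W f" for g
  proof -
    obtain h where h: "h \<in> tensor_relations K V W" "g = h \<oplus>\<^bsub>free_pairs K V W\<^esub> f"
      using mem_tensor_class[OF assms(1,2,4) g] by blast
    have hc: "h \<in> carrier (free_pairs K V W)" using h N.a_subset by auto
    have "c \<odot>\<^bsub>free_pairs K V W\<^esub> g \<ominus>\<^bsub>free_pairs K V W\<^esub> c \<odot>\<^bsub>free_pairs K V W\<^esub> f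
        = c \<odot>\<^bsub>free_pairs K V W\<^esub> h"
      unfolding h(2) a_minus_def using hc assms(3,4)
      by (subst F.smult_r_distr) (auto simp: F.M.a_assoc F.M.r_neg)
    also have "\<dots> \<in> tensor_relations K V W"
      using F.submoduleE(4)[OF tensor_relations_submodule[OF assms(1,2)]] assms h by blast
    finally show ?thesis
      using assms hc by (intro tensor_class_eqI) (auto simp: h(2))
  qed
  then have "(\<Union>g\<in>tensor_class K V W f. tensor_class K V W (c \<odot>\<^bsub>free_pairs K V W\<^esub> g))
      = tensor_class K V W (c \<odot>\<^bsub>free_pairs K V W\<^esub> f)"
    using tensor_class_self[OF assms(1,2,4)] by (intro SUP_eq_const) blast+
  then show ?thesis
    by (simp add: tensor_def Let_def tensor_class_def)
qed

lemma tensor_module: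
  assumes "module K V" "module K W"
  shows "module K (V \<boxtimes>\<^bsub>K\<^esub> W)"
proof -
  interpret F: module K "free_pairs K V W"
    using assms by (intro free_pairs_module module_cring)
  note simps = carrier_tensor tensor_class_add[OF assms] tensor_class_smult[OF assms]
    tensor_class_zero[OF assms, symmetric]
  show ?thesis
  proof (rule moduleI)
    show "abelian_group (V \<boxtimes>\<^bsub>K\<^esub> W)"
    proof (rule abelian_groupI)
      fix x assume "x \<in> carrier (V \<boxtimes>\<^bsub>K\<^esub> W)"
      then obtain f where f: "f \<in> carrier (free_pairs K V W)" "x = tensor_class K V W f"
        by (auto simp: carrier_tensor)
      then show "\<exists>y\<in>carrier (V \<boxtimes>\<^bsub>K\<^esub> W). y \<oplus>\<^bsub>V \<boxtimes>\<^bsub>K\<^esub> W\<^esub> x = \<zero>\<^bsub>V \<boxtimes>\<^bsub>K\<^esub> W\<^esub>"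
        by (intro bexI[of _ "tensor_class K V W (\<ominus>\<^bsub>free_pairs K V W\<^esub> f)"])
          (auto simp: simps F.M.l_neg)
    qed (auto simp: simps F.M.a_ac)
  qed (auto simp: simps F.smult_l_distr F.smult_r_distr F.smult_assoc1 F.R.is_cring)
qed

lemma pure_tensor_eq_class: "pure_tensor K V W v w = tensor_class K V W (single K v w)"
  by (simp add: pure_tensor_def tensor_class_def)

lemma pure_tensor_closed:
  "module K V \<Longrightarrow> v \<in> carrier V \<Longrightarrow> w \<in> carrier W \<Longrightarrow> pure_tensor K V W v w \<in> carrier (V \<boxtimes>\<^bsub>K\<^esub> W)"
  by (simp add: pure_tensor_eq_class tensor_class_closed single_closed module_cring)

lemma bilinearity_relatorsI:
  "\<lbrakk>v \<in> carrier V; v' \<in> carrier V; w \<in> carrier W\<rbrakk> \<Longrightarrow>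
    single K (v \<oplus>\<^bsub>V\<^esub> v') w \<ominus>\<^bsub>free_pairs K V W\<^esub> (single K v w \<oplus>\<^bsub>free_pairs K V W\<^esub> single K v' w)
      \<in> bilinearity_relators K V W"
  "\<lbrakk>v \<in> carrier V; w \<in> carrier W; w' \<in> carrier W\<rbrakk> \<Longrightarrow>
    single K v (w \<oplus>\<^bsub>W\<^esub> w') \<ominus>\<^bsub>free_pairs K V W\<^esub> (single K v w \<oplus>\<^bsub>free_pairs K V W\<^esub> single K v w')
      \<in> bilinearity_relators K V W"
  "\<lbrakk>c \<in> carrier K; v \<in> carrier V; w \<in> carrier W\<rbrakk> \<Longrightarrow>
    single K (c \<odot>\<^bsub>V\<^esub> v) w \<ominus>\<^bsub>free_pairs K V W\<^esub> c \<odot>\<^bsub>free_pairs K V W\<^esub> single K v w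
      \<in> bilinearity_relators K V W"
  "\<lbrakk>c \<in> carrier K; v \<in> carrier V; w \<in> carrier W\<rbrakk> \<Longrightarrow>
    single K v (c \<odot>\<^bsub>W\<^esub> w) \<ominus>\<^bsub>free_pairs K V W\<^esub> c \<odot>\<^bsub>free_pairs K V W\<^esub> single K v w
      \<in> bilinearity_relators K V W"
  unfolding bilinearity_relators_def Let_def by blast+

lemma pure_tensor_bilinear:
  assumes "module K V" "module K W"
  shows "bilinear_map K V W (V \<boxtimes>\<^bsub>K\<^esub> W) (pure_tensor K V W)"
proof -
  interpret V: module K V by fact
  interpret W: module K W by fact
  interpret F: module K "free_pairs K V W"
    using assms by (intro free_pairs_module module_cring)
  note s = single_closed[OF V.R.is_cring]
  have rel: "tensor_class K V W f = tensor_class K V W g"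
    if "f \<in> carrier (free_pairs K V W)" "g \<in> carrier (free_pairs K V W)"
      "f \<ominus>\<^bsub>free_pairs K V W\<^esub> g \<in> bilinearity_relators K V W" for f g
    using that relators_in_tensor_relations by (intro tensor_class_eqI assms) auto
  show ?thesis
  proof (intro bilinear_mapI linear_mapI)
    fix v v' w assume h: "v \<in> carrier V" "v' \<in> carrier V" "w \<in> carrier W"
    show "pure_tensor K V W (v \<oplus>\<^bsub>V\<^esub> v') w
        = pure_tensor K V W v w \<oplus>\<^bsub>V \<boxtimes>\<^bsub>K\<^esub> W\<^esub> pure_tensor K V W v' w"
      using h rel[OF _ _ bilinearity_relatorsI(1)]
      by (simp add: pure_tensor_eq_class tensor_class_add[OF assms] s)
  next
    fix v w w' assume h: "v \<in> carrier V" "w \<in> carrier W" "w' \<in> carrier W"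
    show "pure_tensor K V W v (w \<oplus>\<^bsub>W\<^esub> w')
        = pure_tensor K V W v w \<oplus>\<^bsub>V \<boxtimes>\<^bsub>K\<^esub> W\<^esub> pure_tensor K V W v w'"
      using h rel[OF _ _ bilinearity_relatorsI(2)]
      by (simp add: pure_tensor_eq_class tensor_class_add[OF assms] s)
  next
    fix c v w assume h: "c \<in> carrier K" "v \<in> carrier V" "w \<in> carrier W"
    show "pure_tensor K V W (c \<odot>\<^bsub>V\<^esub> v) w = c \<odot>\<^bsub>V \<boxtimes>\<^bsub>K\<^esub> W\<^esub> pure_tensor K V W v w"
      using h rel[OF _ _ bilinearity_relatorsI(3)]
      by (simp add: pure_tensor_eq_class tensor_class_smult[OF assms] s)
  next
    fix c v w assume h: "c \<in> carrier K" "v \<in> carrier V" "w \<in> carrier W"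
    show "pure_tensor K V W v (c \<odot>\<^bsub>W\<^esub> w) = c \<odot>\<^bsub>V \<boxtimes>\<^bsub>K\<^esub> W\<^esub> pure_tensor K V W v w"
      using h rel[OF _ _ bilinearity_relatorsI(4)]
      by (simp add: pure_tensor_eq_class tensor_class_smult[OF assms] s)
  qed (auto simp: pure_tensor_closed assms)
qed

text \<open>
  No scalar multiples occur in the induction step, since \<open>c (v \<otimes> w) = (c v) \<otimes> w\<close> is again
  pure. The proof peels off one support point of a representative at a time.
\<close>

lemma tensor_induct [consumes 3, case_names zero pure add]:
  assumes VW: "module K V" "module K W" and t: "t \<in> carrier (V \<boxtimes>\<^bsub>K\<^esub> W)"
    and zero: "P \<zero>\<^bsub>V \<boxtimes>\<^bsub>K\<^esub> W\<^esub>"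
    and pure: "\<And>v w. \<lbrakk>v \<in> carrier V; w \<in> carrier W\<rbrakk> \<Longrightarrow> P (pure_tensor K V W v w)"
    and add: "\<And>s t. \<lbrakk>s \<in> carrier (V \<boxtimes>\<^bsub>K\<^esub> W); t \<in> carrier (V \<boxtimes>\<^bsub>K\<^esub> W); P s; P t\<rbrakk> \<Longrightarrow>
      P (s \<oplus>\<^bsub>V \<boxtimes>\<^bsub>K\<^esub> W\<^esub> t)"
  shows "P t"
proof -
  interpret V: module K V by fact
  interpret W: module K W by fact
  interpret F: module K "free_pairs K V W"
    using VW by (intro free_pairs_module module_cring)
  have "P (tensor_class K V W f)"
    if "finite S" "f \<in> carrier (free_pairs K V W)" "{p. f p \<noteq> \<zero>\<^bsub>K\<^esub>} \<subseteq> S" for f S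
    using that
  proof (induction S arbitrary: f rule: finite_induct)
    case empty
    then have "f = \<zero>\<^bsub>free_pairs K V W\<^esub>" by (auto simp: free_pairs_def)
    then show ?case using zero tensor_class_zero[OF VW] by simp
  next
    case (insert p S)
    show ?case
    proof (cases "f p = \<zero>\<^bsub>K\<^esub>")
      case True
      then have "{q. f q \<noteq> \<zero>\<^bsub>K\<^esub>} \<subseteq> S" using insert.prems by auto
      then show ?thesis using insert by blast
    next
      case False
      obtain v w where p: "p = (v, w)" by (cases p)
      have vw: "v \<in> carrier V" "w \<in> carrier W" and c: "f p \<in> carrier K"
        using False insert.prems(1) p by (auto simp: free_pairs_def)
      define g where "g = f(p := \<zero>\<^bsub>K\<^esub>)"
      have "{q. g q \<noteq> \<zero>\<^bsub>K\<^esub>} \<subseteq> {q. f q \<noteq> \<zero>\<^bsub>K\<^esub>}" by (auto simp: g_def)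
      then have g: "g \<in> carrier (free_pairs K V W)"
        using insert.prems(1) finite_subset[of "{q. g q \<noteq> \<zero>\<^bsub>K\<^esub>}"]
        by (auto simp: free_pairs_def Pi_iff g_def)
      have Pg: "P (tensor_class K V W g)"
        using insert.prems by (intro insert.IH g) (auto simp: g_def)
      have sc: "single K v w \<in> carrier (free_pairs K V W)"
        using vw by (intro single_closed V.R.is_cring)
      have f: "f = g \<oplus>\<^bsub>free_pairs K V W\<^esub> f p \<odot>\<^bsub>free_pairs K V W\<^esub> single K v w"
        using insert.prems(1) c by (auto simp: free_pairs_def g_def p single_def fun_eq_iff Pi_iff)
      have "tensor_class K V W f = tensor_class K V W g \<oplus>\<^bsub>V \<boxtimes>\<^bsub>K\<^esub> W\<^esub>
          f p \<odot>\<^bsub>V \<boxtimes>\<^bsub>K\<^esub> W\<^esub> pure_tensor K V W v w"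
        using g sc c
        by (subst f) (simp add: tensor_class_add[OF VW] tensor_class_smult[OF VW] pure_tensor_eq_class)
      also have "f p \<odot>\<^bsub>V \<boxtimes>\<^bsub>K\<^esub> W\<^esub> pure_tensor K V W v w = pure_tensor K V W (f p \<odot>\<^bsub>V\<^esub> v) w"
        using linear_map_smult[OF bilinear_map_left[OF pure_tensor_bilinear[OF VW]]] vw c by simp
      finally show ?thesis
        using Pg pure vw c g by (simp add: add tensor_class_closed pure_tensor_closed VW)
    qed
  qed
  moreover obtain f where "f \<in> carrier (free_pairs K V W)" "t = tensor_class K V W f"
    using t by (auto simp: carrier_tensor)
  ultimately show ?thesis by (auto simp: free_pairs_def)
qed

lemma tensor_ext:
  assumes "module K V" "module K W" "module K U"
    "linear_map K (V \<boxtimes>\<^bsub>K\<^esub> W) U f" "linear_map K (V \<boxtimes>\<^bsub>K\<^esub> W) U g"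
    "\<And>v w. \<lbrakk>v \<in> carrier V; w \<in> carrier W\<rbrakk> \<Longrightarrow> f (pure_tensor K V W v w) = g (pure_tensor K V W v w)"
    "t \<in> carrier (V \<boxtimes>\<^bsub>K\<^esub> W)"
  shows "f t = g t"
  using assms(1,2,7)
proof (induction rule: tensor_induct)
  case zero
  then show ?case
    using assms(3,4,5) tensor_module[OF assms(1,2)] by (metis linear_map_zero)
next
  case (add s t)
  then show ?case
    using assms(4,5) by (simp add: linear_map_add)
qed (use assms(6) in auto)

section \<open>The universal property\<close>

definition pair_sum ::
  "('k, 'r) ring_scheme \<Rightarrow> ('k, 'u, 'm) module_scheme \<Rightarrow> ('v \<Rightarrow> 'w \<Rightarrow> 'u) \<Rightarrow> ('v \<times> 'w \<Rightarrow> 'k) \<Rightarrow> 'u" where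
  "pair_sum K U \<beta> f = (\<Oplus>\<^bsub>U\<^esub> p \<in> {p. f p \<noteq> \<zero>\<^bsub>K\<^esub>}. f p \<odot>\<^bsub>U\<^esub> \<beta> (fst p) (snd p))"

text \<open>
  Linearity needs the sums for two functions over a common index set, whereas the support of a sum
  can be smaller than the union of the supports.
\<close>

lemma pair_sum_superset:
  assumes "module K U" "bilinear_map K V W U \<beta>" "f \<in> carrier (free_pairs K V W)"
    "finite S" "{p. f p \<noteq> \<zero>\<^bsub>K\<^esub>} \<subseteq> S" "S \<subseteq> carrier V \<times> carrier W"
  shows "pair_sum K U \<beta> f = (\<Oplus>\<^bsub>U\<^esub> p \<in> S. f p \<odot>\<^bsub>U\<^esub> \<beta> (fst p) (snd p))"
proof -
  interpret U: module K U by fact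
  have "f p \<in> carrier K" for p using assms(3) by (auto simp: free_pairs_def)
  moreover have "\<beta> (fst p) (snd p) \<in> carrier U" if "p \<in> S" for p
    using that assms(6) bilinear_map_closed[OF assms(2)] by auto
  ultimately show ?thesis
    unfolding pair_sum_def using assms(4,5)
    by (intro U.M.add.finprod_mono_neutral_cong_left) auto
qed

lemma pair_sum_linear:
  assumes "module K V" "module K W" "module K U" "bilinear_map K V W U \<beta>"
  shows "linear_map K (free_pairs K V W) U (pair_sum K U \<beta>)"
proof -
  interpret U: module K U by fact
  interpret F: module K "free_pairs K V W"
    using assms by (intro free_pairs_module module_cring)
  note ps = pair_sum_superset[OF assms(3,4)]
  have val: "f p \<in> carrier K" if "f \<in> carrier (free_pairs K V W)" for f p
    using that by (auto simp: free_pairs_def)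
  have supp: "finite {p. f p \<noteq> \<zero>\<^bsub>K\<^esub>}" "{p. f p \<noteq> \<zero>\<^bsub>K\<^esub>} \<subseteq> carrier V \<times> carrier W"
    if "f \<in> carrier (free_pairs K V W)" for f
    using that by (auto simp: free_pairs_def)
  have \<beta>: "\<beta> (fst p) (snd p) \<in> carrier U" if "p \<in> carrier V \<times> carrier W" for p
    using that bilinear_map_closed[OF assms(4)] by auto
  show ?thesis
  proof (rule linear_mapI)
    fix f assume f: "f \<in> carrier (free_pairs K V W)"
    show "pair_sum K U \<beta> f \<in> carrier U"
      unfolding pair_sum_def using supp[OF f] val[OF f] \<beta> by (intro U.M.finsum_closed) auto
  next
    fix f g assume f: "f \<in> carrier (free_pairs K V W)" and g: "g \<in> carrier (free_pairs K V W)"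
    let ?S = "{p. f p \<noteq> \<zero>\<^bsub>K\<^esub>} \<union> {p. g p \<noteq> \<zero>\<^bsub>K\<^esub>}"
    have S: "finite ?S" "?S \<subseteq> carrier V \<times> carrier W" using supp f g by auto
    have sub: "{p. (f \<oplus>\<^bsub>free_pairs K V W\<^esub> g) p \<noteq> \<zero>\<^bsub>K\<^esub>} \<subseteq> ?S"
      by (auto simp: free_pairs_def)
    have "pair_sum K U \<beta> (f \<oplus>\<^bsub>free_pairs K V W\<^esub> g)
        = (\<Oplus>\<^bsub>U\<^esub> p \<in> ?S. (f p \<oplus>\<^bsub>K\<^esub> g p) \<odot>\<^bsub>U\<^esub> \<beta> (fst p) (snd p))"
      using ps[OF F.M.add.m_closed[OF f g] S(1) sub S(2)] by (simp add: free_pairs_def)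
    also have "\<dots> = (\<Oplus>\<^bsub>U\<^esub> p \<in> ?S. f p \<odot>\<^bsub>U\<^esub> \<beta> (fst p) (snd p) \<oplus>\<^bsub>U\<^esub> g p \<odot>\<^bsub>U\<^esub> \<beta> (fst p) (snd p))"
      using S(2) val[OF f] val[OF g] \<beta> by (intro U.M.finsum_cong') (auto simp: U.smult_l_distr)
    also have "\<dots> = pair_sum K U \<beta> f \<oplus>\<^bsub>U\<^esub> pair_sum K U \<beta> g"
      using ps[OF f S(1) _ S(2)] ps[OF g S(1) _ S(2)] S(2) val[OF f] val[OF g] \<beta>
      by (subst U.M.finsum_addf) auto
    finally show "pair_sum K U \<beta> (f \<oplus>\<^bsub>free_pairs K V W\<^esub> g) = pair_sum K U \<beta> f \<oplus>\<^bsub>U\<^esub> pair_sum K U \<beta> g" .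
  next
    fix c f assume c: "c \<in> carrier K" and f: "f \<in> carrier (free_pairs K V W)"
    let ?S = "{p. f p \<noteq> \<zero>\<^bsub>K\<^esub>}"
    note S = supp[OF f]
    have sub: "{p. (c \<odot>\<^bsub>free_pairs K V W\<^esub> f) p \<noteq> \<zero>\<^bsub>K\<^esub>} \<subseteq> ?S"
      using c by (auto simp: free_pairs_def)
    have "pair_sum K U \<beta> (c \<odot>\<^bsub>free_pairs K V W\<^esub> f)
        = (\<Oplus>\<^bsub>U\<^esub> p \<in> ?S. (c \<otimes>\<^bsub>K\<^esub> f p) \<odot>\<^bsub>U\<^esub> \<beta> (fst p) (snd p))"
      using ps[OF F.smult_closed[OF c f] S(1) sub S(2)] by (simp add: free_pairs_def)
    also have "\<dots> = (\<Oplus>\<^bsub>U\<^esub> p \<in> ?S. c \<odot>\<^bsub>U\<^esub> (f p \<odot>\<^bsub>U\<^esub> \<beta> (fst p) (snd p)))"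
      using S(2) val[OF f] c \<beta> by (intro U.M.finsum_cong') (auto simp: U.smult_assoc1)
    also have "\<dots> = c \<odot>\<^bsub>U\<^esub> pair_sum K U \<beta> f"
      unfolding pair_sum_def using S val[OF f] c \<beta>
      by (subst U.finsum_smult_ldistr) auto
    finally show "pair_sum K U \<beta> (c \<odot>\<^bsub>free_pairs K V W\<^esub> f) = c \<odot>\<^bsub>U\<^esub> pair_sum K U \<beta> f" .
  qed
qed

lemma pair_sum_single:
  assumes "module K U" "bilinear_map K V W U \<beta>" "v \<in> carrier V" "w \<in> carrier W"
  shows "pair_sum K U \<beta> (single K v w) = \<beta> v w"
proof -
  interpret U: module K U by fact
  have \<beta>: "\<beta> v w \<in> carrier U" by (rule bilinear_map_closed[OF assms(2-4)])
  have sub: "{p. single K v w p \<noteq> \<zero>\<^bsub>K\<^esub>} \<subseteq> {(v, w)}"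
    by (auto simp: single_def)
  have "pair_sum K U \<beta> (single K v w) = (\<Oplus>\<^bsub>U\<^esub> p \<in> {(v, w)}. single K v w p \<odot>\<^bsub>U\<^esub> \<beta> (fst p) (snd p))"
    using assms(3,4) by (intro pair_sum_superset[OF assms(1,2)] single_closed U.R.is_cring sub) auto
  also have "\<dots> = \<beta> v w"
    using \<beta> by (simp add: single_def)
  finally show ?thesis .
qed

lemma pair_sum_relations:
  assumes "module K V" "module K W" "module K U" "bilinear_map K V W U \<beta>"
    "f \<in> tensor_relations K V W"
  shows "pair_sum K U \<beta> f = \<zero>\<^bsub>U\<^esub>"
proof -
  interpret V: module K V by fact
  interpret W: module K W by fact
  interpret U: module K U by fact
  interpret F: module K "free_pairs K V W"
    using assms by (intro free_pairs_module module_cring)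
  note L = pair_sum_linear[OF assms(1-4)]
  note s = single_closed[OF V.R.is_cring, of _ V _ W]
  let ?Z = "{f \<in> carrier (free_pairs K V W). pair_sum K U \<beta> f = \<zero>\<^bsub>U\<^esub>}"
  have "submodule ?Z K (free_pairs K V W)"
    using equalizer_submodule[OF F.module_axioms assms(3) L linear_map_const_zero[OF F.module_axioms assms(3)]] .
  moreover have "bilinearity_relators K V W \<subseteq> ?Z"
  proof
    fix r assume r: "r \<in> bilinearity_relators K V W"
    have diff: "pair_sum K U \<beta> (x \<ominus>\<^bsub>free_pairs K V W\<^esub> y) = \<zero>\<^bsub>U\<^esub>"
      if "x \<in> carrier (free_pairs K V W)" "y \<in> carrier (free_pairs K V W)"
        "pair_sum K U \<beta> x = pair_sum K U \<beta> y" for x y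
      using that linear_map_closed[OF L, of y]
      by (simp add: linear_map_a_minus[OF F.module_axioms assms(3) L] a_minus_def[of U] U.M.r_neg)
    note ev = pair_sum_single[OF assms(3,4)] linear_map_add[OF L] linear_map_smult[OF L]
      linear_map_add[OF bilinear_map_left[OF assms(4)]] linear_map_add[OF bilinear_map_right[OF assms(4)]]
      linear_map_smult[OF bilinear_map_left[OF assms(4)]] linear_map_smult[OF bilinear_map_right[OF assms(4)]]
    have "pair_sum K U \<beta> r = \<zero>\<^bsub>U\<^esub>"
      using r unfolding bilinearity_relators_def Let_def
      by (elim UnE CollectE exE conjE; hypsubst; intro diff) (simp_all add: s ev)
    then show "r \<in> ?Z" using bilinearity_relators_closed[OF assms(1,2)] r by auto
  qed
  ultimately show ?thesis
    using tensor_relations_least assms(5) by blast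
qed

text \<open>
  The representative picked by \<open>tensor_lift\<close> differs from \<open>f\<close> by a relation, on which
  \<open>pair_sum\<close> vanishes.
\<close>

lemma tensor_lift_class:
  assumes "module K V" "module K W" "module K U" "bilinear_map K V W U \<beta>"
    "f \<in> carrier (free_pairs K V W)"
  shows "tensor_lift K U \<beta> (tensor_class K V W f) = pair_sum K U \<beta> f"
proof -
  interpret U: module K U by fact
  interpret F: module K "free_pairs K V W"
    using assms by (intro free_pairs_module module_cring)
  note L = pair_sum_linear[OF assms(1-4)]
  have "(SOME g. g \<in> tensor_class K V W f) \<in> tensor_class K V W f"
    using tensor_class_self[OF assms(1,2,5)] by (simp add: someI[of "\<lambda>g. g \<in> tensor_class K V W f"])
  then obtain h where h: "h \<in> tensor_relations K V W"
      "(SOME g. g \<in> tensor_class K V W f) = h \<oplus>\<^bsub>free_pairs K V W\<^esub> f"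
    using mem_tensor_class[OF assms(1,2,5)] by metis
  have "h \<in> carrier (free_pairs K V W)"
    using h F.submoduleE(1)[OF tensor_relations_submodule[OF assms(1,2)]] by auto
  then have "pair_sum K U \<beta> (h \<oplus>\<^bsub>free_pairs K V W\<^esub> f) = pair_sum K U \<beta> f"
    using pair_sum_relations[OF assms(1-4) h(1)] linear_map_closed[OF L assms(5)]
    by (simp add: linear_map_add[OF L] assms(5))
  then show ?thesis
    by (simp add: tensor_lift_def Let_def h(2) pair_sum_def)
qed

lemma tensor_lift_linear:
  assumes "module K V" "module K W" "module K U" "bilinear_map K V W U \<beta>"
  shows "linear_map K (V \<boxtimes>\<^bsub>K\<^esub> W) U (tensor_lift K U \<beta>)"
proof -
  interpret F: module K "free_pairs K V W"
    using assms by (intro free_pairs_module module_cring)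
  note L = pair_sum_linear[OF assms]
  show ?thesis
    by (rule linear_mapI)
      (auto simp: carrier_tensor tensor_class_add[OF assms(1,2)] tensor_class_smult[OF assms(1,2)]
        tensor_lift_class[OF assms] linear_map_add[OF L] linear_map_smult[OF L] linear_map_closed[OF L])
qed

lemma tensor_lift_pure:
  assumes "module K V" "module K W" "module K U" "bilinear_map K V W U \<beta>"
    "v \<in> carrier V" "w \<in> carrier W"
  shows "tensor_lift K U \<beta> (pure_tensor K V W v w) = \<beta> v w"
  using assms by (simp add: pure_tensor_eq_class tensor_lift_class single_closed module_cring pair_sum_single)

section \<open>Functoriality and associativity of the tensor product\<close>

text \<open>
  The associator is a lift of a map that is itself a lift depending on a parameter; this lemma gives
  its linearity in the parameter.
\<close>

lemma tensor_lift_linear_param: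
  assumes "module K P" "module K V" "module K W" "module K U"
    and bil: "\<And>p. p \<in> carrier P \<Longrightarrow> bilinear_map K V W U (\<beta> p)"
    and lin: "\<And>v w. \<lbrakk>v \<in> carrier V; w \<in> carrier W\<rbrakk> \<Longrightarrow> linear_map K P U (\<lambda>p. \<beta> p v w)"
    and t: "t \<in> carrier (V \<boxtimes>\<^bsub>K\<^esub> W)"
  shows "linear_map K P U (\<lambda>p. tensor_lift K U (\<beta> p) t)"
proof -
  interpret P: module K P by fact
  interpret U: module K U by fact
  note L = tensor_lift_linear[OF assms(2-4) bil] and ev = tensor_lift_pure[OF assms(2-4) bil]
  show ?thesis
  proof (rule linear_mapI)
    fix p assume "p \<in> carrier P"
    then show "tensor_lift K U (\<beta> p) t \<in> carrier U" using L t by (meson linear_map_closed)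
  next
    fix p q assume pq: "p \<in> carrier P" "q \<in> carrier P"
    then have pq': "p \<oplus>\<^bsub>P\<^esub> q \<in> carrier P" by simp
    show "tensor_lift K U (\<beta> (p \<oplus>\<^bsub>P\<^esub> q)) t = tensor_lift K U (\<beta> p) t \<oplus>\<^bsub>U\<^esub> tensor_lift K U (\<beta> q) t"
      by (rule tensor_ext[OF assms(2-4) L[OF pq'] linear_map_sum[OF assms(4) L[OF pq(1)] L[OF pq(2)]] _ t])
        (simp add: ev pq linear_map_add[OF lin])
  next
    fix c p assume c: "c \<in> carrier K" and p: "p \<in> carrier P"
    then have p': "c \<odot>\<^bsub>P\<^esub> p \<in> carrier P" by simp
    show "tensor_lift K U (\<beta> (c \<odot>\<^bsub>P\<^esub> p)) t = c \<odot>\<^bsub>U\<^esub> tensor_lift K U (\<beta> p) t"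
      by (rule tensor_ext[OF assms(2-4) L[OF p'] linear_map_scale[OF assms(4) L[OF p] c] _ t])
        (simp add: ev p c linear_map_smult[OF lin])
  qed
qed

lemma pure_tensor_linear_right:
  "module K V \<Longrightarrow> module K W \<Longrightarrow> v \<in> carrier V \<Longrightarrow> linear_map K W (V \<boxtimes>\<^bsub>K\<^esub> W) (pure_tensor K V W v)"
  by (rule bilinear_map_right[OF pure_tensor_bilinear])

lemma pure_tensor_linear_left:
  "module K V \<Longrightarrow> module K W \<Longrightarrow> w \<in> carrier W \<Longrightarrow>
    linear_map K V (V \<boxtimes>\<^bsub>K\<^esub> W) (\<lambda>v. pure_tensor K V W v w)"
  by (rule bilinear_map_left[OF pure_tensor_bilinear])

context
  fixes K :: "('k, 'r) ring_scheme"
    and X :: "('k, 'x, 'm1) module_scheme" and Y :: "('k, 'y, 'm2) module_scheme"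
    and V :: "('k, 'v, 'm3) module_scheme" and W :: "('k, 'w, 'm4) module_scheme"
    and f :: "'x \<Rightarrow> 'v" and g :: "'y \<Rightarrow> 'w"
  assumes XY: "module K X" "module K Y" and VW: "module K V" "module K W"
    and f: "linear_map K X V f" and g: "linear_map K Y W g"
begin

lemma tensor_map_bilinear:
  "bilinear_map K X Y (V \<boxtimes>\<^bsub>K\<^esub> W) (\<lambda>x y. pure_tensor K V W (f x) (g y))"
  by (intro bilinear_mapI linear_map_comp[OF g pure_tensor_linear_right[OF VW]]
      linear_map_comp[OF f pure_tensor_linear_left[OF VW]] linear_map_closed[OF f] linear_map_closed[OF g])

lemma tensor_map_linear: "linear_map K (X \<boxtimes>\<^bsub>K\<^esub> Y) (V \<boxtimes>\<^bsub>K\<^esub> W) (tensor_map K V W f g)"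
  unfolding tensor_map_def
  by (rule tensor_lift_linear[OF XY tensor_module[OF VW] tensor_map_bilinear])

lemma tensor_map_closed:
  "t \<in> carrier (X \<boxtimes>\<^bsub>K\<^esub> Y) \<Longrightarrow> tensor_map K V W f g t \<in> carrier (V \<boxtimes>\<^bsub>K\<^esub> W)"
  by (rule linear_map_closed[OF tensor_map_linear])

lemma tensor_map_pure:
  "x \<in> carrier X \<Longrightarrow> y \<in> carrier Y \<Longrightarrow>
    tensor_map K V W f g (pure_tensor K X Y x y) = pure_tensor K V W (f x) (g y)"
  unfolding tensor_map_def
  by (rule tensor_lift_pure[OF XY tensor_module[OF VW] tensor_map_bilinear])

end

lemma tensor_map_id:
  assumes "module K V" "module K W" "t \<in> carrier (V \<boxtimes>\<^bsub>K\<^esub> W)"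
  shows "tensor_map K V W id id t = t"
  by (rule tensor_ext[OF assms(1,2) tensor_module[OF assms(1,2)]
        tensor_map_linear[OF assms(1,2,1,2) linear_map_id linear_map_id] linear_map_ident _ assms(3)])
    (simp add: tensor_map_pure[OF assms(1,2,1,2) linear_map_id linear_map_id])

text \<open>
  The composites may be replaced by any functions that agree with them on the carriers, so that a
  step also absorbs simplifications such as \<open>\<alpha>' (\<pi> a) = \<pi> (\<alpha> a)\<close>.
\<close>

lemma tensor_map_comp:
  assumes "module K X" "module K Y" "module K V" "module K W" "module K V'" "module K W'"
    and f: "linear_map K X V f" and g: "linear_map K Y W g"
    and f': "linear_map K V V' f'" and g': "linear_map K W W' g'"
    and p: "\<And>x. x \<in> carrier X \<Longrightarrow> f' (f x) = p x"
    and q: "\<And>y. y \<in> carrier Y \<Longrightarrow> g' (g y) = q y"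
    and t: "t \<in> carrier (X \<boxtimes>\<^bsub>K\<^esub> Y)"
  shows "tensor_map K V' W' f' g' (tensor_map K V W f g t) = tensor_map K V' W' p q t"
proof -
  note c = linear_map_cong[OF assms(1) linear_map_comp[OF f f'] p]
    linear_map_cong[OF assms(2) linear_map_comp[OF g g'] q]
  show ?thesis
    by (rule tensor_ext[OF assms(1,2) tensor_module[OF assms(5,6)]
          linear_map_comp[OF tensor_map_linear[OF assms(1-4) f g] tensor_map_linear[OF assms(3-6) f' g']]
          tensor_map_linear[OF assms(1,2,5,6) c] _ t])
      (simp_all add: tensor_map_pure[OF assms(1-4) f g] tensor_map_pure[OF assms(3-6) f' g']
        tensor_map_pure[OF assms(1,2,5,6) c] linear_map_closed[OF f] linear_map_closed[OF g] p q)
qed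

context
  fixes K :: "('k, 'r) ring_scheme"
    and V :: "('k, 'v, 'm1) module_scheme" and W :: "('k, 'w, 'm2) module_scheme"
    and U :: "('k, 'u, 'm3) module_scheme"
  assumes V: "module K V" and W: "module K W" and U: "module K U"
begin

lemma assoc_left_inner_bilinear:
  assumes "v \<in> carrier V"
  shows "bilinear_map K W U ((V \<boxtimes>\<^bsub>K\<^esub> W) \<boxtimes>\<^bsub>K\<^esub> U)
    (\<lambda>w u. pure_tensor K (V \<boxtimes>\<^bsub>K\<^esub> W) U (pure_tensor K V W v w) u)"
  by (intro bilinear_mapI pure_tensor_linear_right tensor_module V W U pure_tensor_closed assms
      linear_map_comp[OF pure_tensor_linear_right[OF V W assms] pure_tensor_linear_left])

lemma assoc_left_outer_bilinear:
  "bilinear_map K V (W \<boxtimes>\<^bsub>K\<^esub> U) ((V \<boxtimes>\<^bsub>K\<^esub> W) \<boxtimes>\<^bsub>K\<^esub> U)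
    (\<lambda>v. tensor_lift K ((V \<boxtimes>\<^bsub>K\<^esub> W) \<boxtimes>\<^bsub>K\<^esub> U)
      (\<lambda>w u. pure_tensor K (V \<boxtimes>\<^bsub>K\<^esub> W) U (pure_tensor K V W v w) u))"
  by (intro bilinear_mapI tensor_lift_linear[OF W U] tensor_lift_linear_param[OF V W U]
      tensor_module V W U assoc_left_inner_bilinear
      linear_map_comp[OF pure_tensor_linear_left[OF V W] pure_tensor_linear_left])

lemma assoc_left_linear:
  "linear_map K (V \<boxtimes>\<^bsub>K\<^esub> (W \<boxtimes>\<^bsub>K\<^esub> U)) ((V \<boxtimes>\<^bsub>K\<^esub> W) \<boxtimes>\<^bsub>K\<^esub> U) (assoc_left K V W U)"
  unfolding assoc_left_def
  by (intro tensor_lift_linear tensor_module V W U assoc_left_outer_bilinear)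

lemma assoc_left_closed:
  "t \<in> carrier (V \<boxtimes>\<^bsub>K\<^esub> (W \<boxtimes>\<^bsub>K\<^esub> U)) \<Longrightarrow> assoc_left K V W U t \<in> carrier ((V \<boxtimes>\<^bsub>K\<^esub> W) \<boxtimes>\<^bsub>K\<^esub> U)"
  by (rule linear_map_closed[OF assoc_left_linear])

lemma assoc_left_pure:
  assumes "v \<in> carrier V" "w \<in> carrier W" "u \<in> carrier U"
  shows "assoc_left K V W U (pure_tensor K V (W \<boxtimes>\<^bsub>K\<^esub> U) v (pure_tensor K W U w u))
    = pure_tensor K (V \<boxtimes>\<^bsub>K\<^esub> W) U (pure_tensor K V W v w) u"
proof -
  note T = tensor_module[OF tensor_module[OF V W] U]
  show ?thesis
    unfolding assoc_left_def
    using assms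
    by (subst tensor_lift_pure[OF V tensor_module[OF W U] T assoc_left_outer_bilinear])
      (auto intro: pure_tensor_closed W simp: tensor_lift_pure[OF W U T assoc_left_inner_bilinear])
qed

lemma assoc_left_pure_linear:
  "v \<in> carrier V \<Longrightarrow>
    linear_map K (W \<boxtimes>\<^bsub>K\<^esub> U) ((V \<boxtimes>\<^bsub>K\<^esub> W) \<boxtimes>\<^bsub>K\<^esub> U) (\<lambda>s. assoc_left K V W U (pure_tensor K V (W \<boxtimes>\<^bsub>K\<^esub> U) v s))"
  by (intro linear_map_comp[OF pure_tensor_linear_right assoc_left_linear] V W U tensor_module)

lemma tensor_ext3:
  assumes "module K Z"
    "linear_map K (V \<boxtimes>\<^bsub>K\<^esub> (W \<boxtimes>\<^bsub>K\<^esub> U)) Z f" "linear_map K (V \<boxtimes>\<^bsub>K\<^esub> (W \<boxtimes>\<^bsub>K\<^esub> U)) Z g"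
    "\<And>v w u. \<lbrakk>v \<in> carrier V; w \<in> carrier W; u \<in> carrier U\<rbrakk> \<Longrightarrow>
      f (pure_tensor K V (W \<boxtimes>\<^bsub>K\<^esub> U) v (pure_tensor K W U w u))
      = g (pure_tensor K V (W \<boxtimes>\<^bsub>K\<^esub> U) v (pure_tensor K W U w u))"
    "t \<in> carrier (V \<boxtimes>\<^bsub>K\<^esub> (W \<boxtimes>\<^bsub>K\<^esub> U))"
  shows "f t = g t"
proof (rule tensor_ext[OF V tensor_module[OF W U] assms(1-3) _ assms(5)])
  fix v s assume v: "v \<in> carrier V" and s: "s \<in> carrier (W \<boxtimes>\<^bsub>K\<^esub> U)"
  note p = pure_tensor_linear_right[OF V tensor_module[OF W U] v]
  show "f (pure_tensor K V (W \<boxtimes>\<^bsub>K\<^esub> U) v s) = g (pure_tensor K V (W \<boxtimes>\<^bsub>K\<^esub> U) v s)"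
    by (rule tensor_ext[OF W U assms(1) linear_map_comp[OF p assms(2)] linear_map_comp[OF p assms(3)]
          assms(4)[OF v] s])
qed

end

lemma assoc_left_natural:
  assumes V: "module K V" and W: "module K W" and U: "module K U"
    and V': "module K V'" and W': "module K W'" and U': "module K U'"
    and f: "linear_map K V V' f" and g: "linear_map K W W' g" and h: "linear_map K U U' h"
    and t: "t \<in> carrier (V \<boxtimes>\<^bsub>K\<^esub> (W \<boxtimes>\<^bsub>K\<^esub> U))"
  shows "assoc_left K V' W' U' (tensor_map K V' (W' \<boxtimes>\<^bsub>K\<^esub> U') f (tensor_map K W' U' g h) t)
    = tensor_map K (V' \<boxtimes>\<^bsub>K\<^esub> W') U' (tensor_map K V' W' f g) h (assoc_left K V W U t)"
proof -
  note VW = tensor_module[OF V W] and VW' = tensor_module[OF V' W']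
    and WU = tensor_module[OF W U] and WU' = tensor_module[OF W' U']
  note fg = tensor_map_linear[OF V W V' W' f g] and gh = tensor_map_linear[OF W U W' U' g h]
  note ev = tensor_map_pure[OF V W V' W' f g] tensor_map_pure[OF W U W' U' g h]
    tensor_map_pure[OF V WU V' WU' f gh] tensor_map_pure[OF VW U VW' U' fg h]
    assoc_left_pure[OF V W U] assoc_left_pure[OF V' W' U']
    linear_map_closed[OF f] linear_map_closed[OF g] linear_map_closed[OF h]
    pure_tensor_closed[OF V] pure_tensor_closed[OF W]
  show ?thesis
    by (rule tensor_ext3[OF V W U tensor_module[OF VW' U']
          linear_map_comp[OF tensor_map_linear[OF V WU V' WU' f gh] assoc_left_linear[OF V' W' U']]
          linear_map_comp[OF assoc_left_linear[OF V W U] tensor_map_linear[OF VW U VW' U' fg h]] _ t])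
      (simp add: ev)
qed

lemma tensor_map_bij_betw:
  assumes X: "module K X" and Y: "module K Y" and V: "module K V" and W: "module K W"
    and f: "linear_map K X V f" and g: "linear_map K Y W g"
    and bf: "bij_betw f (carrier X) (carrier V)" and bg: "bij_betw g (carrier Y) (carrier W)"
  shows "bij_betw (tensor_map K V W f g) (carrier (X \<boxtimes>\<^bsub>K\<^esub> Y)) (carrier (V \<boxtimes>\<^bsub>K\<^esub> W))"
proof -
  let ?f = "inv_into (carrier X) f" and ?g = "inv_into (carrier Y) g"
  note f' = linear_map_inv_into[OF X f bf] and g' = linear_map_inv_into[OF Y g bg]
  have left: "tensor_map K X Y ?f ?g (tensor_map K V W f g t) = t" if t: "t \<in> carrier (X \<boxtimes>\<^bsub>K\<^esub> Y)" for t
  proof -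
    have "tensor_map K X Y ?f ?g (tensor_map K V W f g t) = tensor_map K X Y id id t"
      by (rule tensor_map_comp[OF X Y V W X Y f g f' g' _ _ t])
        (simp_all add: bij_betw_inv_into_left[OF bf] bij_betw_inv_into_left[OF bg])
    then show ?thesis by (simp add: tensor_map_id[OF X Y t])
  qed
  have right: "tensor_map K V W f g (tensor_map K X Y ?f ?g t) = t" if t: "t \<in> carrier (V \<boxtimes>\<^bsub>K\<^esub> W)" for t
  proof -
    have "tensor_map K V W f g (tensor_map K X Y ?f ?g t) = tensor_map K V W id id t"
      by (rule tensor_map_comp[OF V W X Y V W f' g' f g _ _ t])
        (simp_all add: bij_betw_inv_into_right[OF bf] bij_betw_inv_into_right[OF bg])
    then show ?thesis by (simp add: tensor_map_id[OF V W t])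
  qed
  show ?thesis
  proof (rule bij_betw_byWitness[where f' = "tensor_map K X Y ?f ?g"])
    show "tensor_map K V W f g ` carrier (X \<boxtimes>\<^bsub>K\<^esub> Y) \<subseteq> carrier (V \<boxtimes>\<^bsub>K\<^esub> W)"
      using tensor_map_closed[OF X Y V W f g] by blast
    show "tensor_map K X Y ?f ?g ` carrier (V \<boxtimes>\<^bsub>K\<^esub> W) \<subseteq> carrier (X \<boxtimes>\<^bsub>K\<^esub> Y)"
      using tensor_map_closed[OF V W X Y f' g'] by blast
  qed (use left right in blast)+
qed

section \<open>Exactness of the tensor product over a field\<close>

text \<open>
  Zorn's lemma. If \<open>K\<close> is a field and \<open>a\<close> lies in the module, the submodule obtained is a
  complement of the line through \<open>a\<close>.
\<close>

lemma maximal_avoiding_submodule: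
  assumes "module K A" "submodule U K A" "a \<notin> U"
  obtains W where "submodule W K A" "U \<subseteq> W" "a \<notin> W"
    "\<And>W'. \<lbrakk>submodule W' K A; W \<subseteq> W'; a \<notin> W'\<rbrakk> \<Longrightarrow> W' = W"
proof -
  interpret A: module K A by fact
  let ?S = "{W. submodule W K A \<and> U \<subseteq> W \<and> a \<notin> W}"
  have "\<exists>M\<in>?S. \<forall>X\<in>?S. M \<subseteq> X \<longrightarrow> X = M"
  proof (rule subset_Zorn_nonempty)
    show "?S \<noteq> {}" using assms by auto
  next
    fix C assume C: "C \<noteq> {}" "subset.chain ?S C"
    have mem: "X \<in> C \<Longrightarrow> X \<in> ?S" for X using C(2) by (auto simp: subset.chain_def)
    have dir: "X \<in> C \<Longrightarrow> Y \<in> C \<Longrightarrow> X \<subseteq> Y \<or> Y \<subseteq> X" for X Y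
      using C(2) by (auto simp: subset.chain_def)
    have "submodule (\<Union>C) K A"
    proof (rule A.submoduleI)
      obtain X where X: "X \<in> C" using C(1) by auto
      then have "\<zero>\<^bsub>A\<^esub> \<in> X"
        using mem[OF X] subgroup.one_closed[of X "add_monoid A"] by (auto simp: submodule_def)
      then show "\<zero>\<^bsub>A\<^esub> \<in> \<Union>C" using X by auto
    next
      fix x y assume "x \<in> \<Union>C" "y \<in> \<Union>C"
      then obtain X Y where XY: "x \<in> X" "X \<in> C" "y \<in> Y" "Y \<in> C" by auto
      then obtain Z where "Z \<in> C" "x \<in> Z" "y \<in> Z" using dir[of X Y] by blast
      then show "x \<oplus>\<^bsub>A\<^esub> y \<in> \<Union>C"
        using mem[of Z] A.submoduleE(5)[of Z x y] by auto
    next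
      show "\<Union>C \<subseteq> carrier A" using mem A.submoduleE(1) by (intro Union_least) auto
    next
      fix x assume "x \<in> \<Union>C"
      then obtain X where "x \<in> X" "X \<in> C" by auto
      then show "\<ominus>\<^bsub>A\<^esub> x \<in> \<Union>C" using mem[of X] A.submoduleE(3)[of X x] by auto
    next
      fix c x assume "c \<in> carrier K" "x \<in> \<Union>C"
      then obtain X where "c \<in> carrier K" "x \<in> X" "X \<in> C" by auto
      then show "c \<odot>\<^bsub>A\<^esub> x \<in> \<Union>C" using mem[of X] A.submoduleE(4)[of X c x] by auto
    qed
    then show "\<Union>C \<in> ?S" using C(1) mem by blast
  qed
  then obtain M where M: "M \<in> ?S" and max: "\<forall>X\<in>?S. M \<subseteq> X \<longrightarrow> X = M"
    by (rule bexE)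
  show thesis
  proof (rule that[of M])
    fix W' assume W': "submodule W' K A" "M \<subseteq> W'" "a \<notin> W'"
    then have "W' \<in> ?S" using M by auto
    then show "W' = M" using max W'(2) by simp
  qed (use M in simp_all)
qed

text \<open>
  Let \<open>W \<supseteq> U\<close> be maximal among the subspaces avoiding \<open>a\<close>. For \<open>x \<notin> W\<close> maximality puts \<open>a\<close>
  into \<open>W + K x\<close>, and as scalars are invertible this gives \<open>x \<in> W + K a\<close>. So the whole space is the direct
  sum of \<open>W\<close> and \<open>K a\<close>, and the functional is the coefficient of \<open>a\<close>.
\<close>

lemma separating_functional:
  assumes "field K" "module K A" "submodule U K A" "a \<in> carrier A" "a \<notin> U"
  obtains \<phi> where "linear_map K A (ground_module K) \<phi>" "\<And>x. x \<in> U \<Longrightarrow> \<phi> x = \<zero>\<^bsub>K\<^esub>" "\<phi> a = \<one>\<^bsub>K\<^esub>"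
proof -
  interpret K: field K by fact
  interpret A: module K A by fact
  obtain W where W: "submodule W K A" "U \<subseteq> W" "a \<notin> W"
    and max: "\<And>W'. \<lbrakk>submodule W' K A; W \<subseteq> W'; a \<notin> W'\<rbrakk> \<Longrightarrow> W' = W"
    by (rule maximal_avoiding_submodule[OF assms(2,3,5)], rule that)
  note Wc = A.submoduleE[OF W(1)]
  have W0: "\<zero>\<^bsub>A\<^esub> \<in> W"
    using subgroup.one_closed[OF submodule.axioms(1)[OF W(1)]] by simp
  have Wsub: "w \<in> W \<Longrightarrow> w \<in> carrier A" for w using Wc(1) by auto
  have unit: "c \<in> carrier K \<Longrightarrow> c \<noteq> \<zero>\<^bsub>K\<^esub> \<Longrightarrow>
      inv\<^bsub>K\<^esub> c \<in> carrier K \<and> inv\<^bsub>K\<^esub> c \<otimes>\<^bsub>K\<^esub> c = \<one>\<^bsub>K\<^esub>" for c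
    using K.field_Units by auto
  have ex: "\<exists>c\<in>carrier K. \<exists>w\<in>W. x = w \<oplus>\<^bsub>A\<^esub> c \<odot>\<^bsub>A\<^esub> a" if x: "x \<in> carrier A" for x
  proof (cases "x \<in> W")
    case True
    then show ?thesis using x assms(4) by (intro bexI[of _ "\<zero>\<^bsub>K\<^esub>"] bexI[of _ x]) auto
  next
    case False
    let ?W' = "{w \<oplus>\<^bsub>A\<^esub> c \<odot>\<^bsub>A\<^esub> x | w c. w \<in> W \<and> c \<in> carrier K}"
    have sub: "submodule ?W' K A"
    proof (rule A.submoduleI)
      show "?W' \<subseteq> carrier A" using Wsub x by auto
      show "\<zero>\<^bsub>A\<^esub> \<in> ?W'"
        using W0 x by (intro CollectI exI[of _ "\<zero>\<^bsub>A\<^esub>"] exI[of _ "\<zero>\<^bsub>K\<^esub>"]) simp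
    next
      fix y assume "y \<in> ?W'"
      then obtain w c where y: "y = w \<oplus>\<^bsub>A\<^esub> c \<odot>\<^bsub>A\<^esub> x" "w \<in> W" "c \<in> carrier K" by auto
      then have "\<ominus>\<^bsub>A\<^esub> y = \<ominus>\<^bsub>A\<^esub> w \<oplus>\<^bsub>A\<^esub> (\<ominus>\<^bsub>K\<^esub> c) \<odot>\<^bsub>A\<^esub> x"
        using x Wsub by (simp add: A.M.minus_add A.smult_l_minus)
      then show "\<ominus>\<^bsub>A\<^esub> y \<in> ?W'"
        using y Wc(3) by (intro CollectI exI[of _ "\<ominus>\<^bsub>A\<^esub> w"] exI[of _ "\<ominus>\<^bsub>K\<^esub> c"]) simp
    next
      fix y z assume "y \<in> ?W'" "z \<in> ?W'"
      then obtain w c w' c' where y: "y = w \<oplus>\<^bsub>A\<^esub> c \<odot>\<^bsub>A\<^esub> x" "w \<in> W" "c \<in> carrier K"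
        and z: "z = w' \<oplus>\<^bsub>A\<^esub> c' \<odot>\<^bsub>A\<^esub> x" "w' \<in> W" "c' \<in> carrier K" by auto
      then have "y \<oplus>\<^bsub>A\<^esub> z = (w \<oplus>\<^bsub>A\<^esub> w') \<oplus>\<^bsub>A\<^esub> (c \<oplus>\<^bsub>K\<^esub> c') \<odot>\<^bsub>A\<^esub> x"
        using x Wsub by (simp add: A.smult_l_distr A.M.a_ac)
      then show "y \<oplus>\<^bsub>A\<^esub> z \<in> ?W'"
        using y z Wc(5) by (intro CollectI exI[of _ "w \<oplus>\<^bsub>A\<^esub> w'"] exI[of _ "c \<oplus>\<^bsub>K\<^esub> c'"]) simp
    next
      fix d y assume d: "d \<in> carrier K" and "y \<in> ?W'"
      then obtain w c where y: "y = w \<oplus>\<^bsub>A\<^esub> c \<odot>\<^bsub>A\<^esub> x" "w \<in> W" "c \<in> carrier K" by auto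
      then have "d \<odot>\<^bsub>A\<^esub> y = d \<odot>\<^bsub>A\<^esub> w \<oplus>\<^bsub>A\<^esub> (d \<otimes>\<^bsub>K\<^esub> c) \<odot>\<^bsub>A\<^esub> x"
        using x d Wsub by (simp add: A.smult_r_distr A.smult_assoc1)
      then show "d \<odot>\<^bsub>A\<^esub> y \<in> ?W'"
        using y d Wc(4) by (intro CollectI exI[of _ "d \<odot>\<^bsub>A\<^esub> w"] exI[of _ "d \<otimes>\<^bsub>K\<^esub> c"]) simp
    qed
    have WW': "W \<subseteq> ?W'"
    proof
      fix w assume "w \<in> W"
      then show "w \<in> ?W'"
        using x Wsub by (intro CollectI exI[of _ w] exI[of _ "\<zero>\<^bsub>K\<^esub>"]) simp
    qed
    have "x \<in> ?W'"
      using x W0 by (intro CollectI exI[of _ "\<zero>\<^bsub>A\<^esub>"] exI[of _ "\<one>\<^bsub>K\<^esub>"]) simp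
    then have "a \<in> ?W'" using max[OF sub WW'] False by auto
    then obtain w c where a: "a = w \<oplus>\<^bsub>A\<^esub> c \<odot>\<^bsub>A\<^esub> x" and w: "w \<in> W" and c: "c \<in> carrier K" by auto
    have "c \<noteq> \<zero>\<^bsub>K\<^esub>" using a w x W(3) Wsub by auto
    then have i: "inv\<^bsub>K\<^esub> c \<in> carrier K" "inv\<^bsub>K\<^esub> c \<otimes>\<^bsub>K\<^esub> c = \<one>\<^bsub>K\<^esub>" using unit[OF c] by auto
    have "inv\<^bsub>K\<^esub> c \<odot>\<^bsub>A\<^esub> a = inv\<^bsub>K\<^esub> c \<odot>\<^bsub>A\<^esub> w \<oplus>\<^bsub>A\<^esub> (inv\<^bsub>K\<^esub> c \<otimes>\<^bsub>K\<^esub> c) \<odot>\<^bsub>A\<^esub> x"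
      unfolding a using x c i(1) w Wsub by (simp add: A.smult_r_distr A.smult_assoc1)
    also have "\<dots> = inv\<^bsub>K\<^esub> c \<odot>\<^bsub>A\<^esub> w \<oplus>\<^bsub>A\<^esub> x" using i x by simp
    finally have "\<ominus>\<^bsub>A\<^esub> (inv\<^bsub>K\<^esub> c \<odot>\<^bsub>A\<^esub> w) \<oplus>\<^bsub>A\<^esub> inv\<^bsub>K\<^esub> c \<odot>\<^bsub>A\<^esub> a = x"
      using i x w Wsub assms(4) by (simp add: A.M.r_neg1)
    then show ?thesis
      using i w Wc(3,4) by (intro bexI[of _ "inv\<^bsub>K\<^esub> c"] bexI[of _ "\<ominus>\<^bsub>A\<^esub> (inv\<^bsub>K\<^esub> c \<odot>\<^bsub>A\<^esub> w)"]) auto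
  qed
  have uniq: "c = d"
    if cd: "c \<in> carrier K" "d \<in> carrier K" and wv: "w \<in> W" "v \<in> W"
      and eq: "w \<oplus>\<^bsub>A\<^esub> c \<odot>\<^bsub>A\<^esub> a = v \<oplus>\<^bsub>A\<^esub> d \<odot>\<^bsub>A\<^esub> a" for c d w v
  proof (rule ccontr)
    assume "c \<noteq> d"
    have "c = (c \<ominus>\<^bsub>K\<^esub> d) \<oplus>\<^bsub>K\<^esub> d"
      using cd by (simp add: a_minus_def K.a_assoc K.l_neg)
    then have n: "c \<ominus>\<^bsub>K\<^esub> d \<noteq> \<zero>\<^bsub>K\<^esub>" "c \<ominus>\<^bsub>K\<^esub> d \<in> carrier K"
      using cd \<open>c \<noteq> d\<close> by auto
    have m: "c \<odot>\<^bsub>A\<^esub> a \<in> carrier A" "d \<odot>\<^bsub>A\<^esub> a \<in> carrier A" "w \<in> carrier A" "v \<in> carrier A"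
      using cd assms(4) wv Wsub by auto
    have "c \<odot>\<^bsub>A\<^esub> a = \<ominus>\<^bsub>A\<^esub> w \<oplus>\<^bsub>A\<^esub> (v \<oplus>\<^bsub>A\<^esub> d \<odot>\<^bsub>A\<^esub> a)"
      using m by (simp add: eq[symmetric] A.M.r_neg1)
    then have "(c \<ominus>\<^bsub>K\<^esub> d) \<odot>\<^bsub>A\<^esub> a = \<ominus>\<^bsub>A\<^esub> w \<oplus>\<^bsub>A\<^esub> v"
      using m cd assms(4) by (simp add: a_minus_def A.smult_l_distr A.smult_l_minus A.M.a_assoc A.M.r_neg)
    then have "(c \<ominus>\<^bsub>K\<^esub> d) \<odot>\<^bsub>A\<^esub> a \<in> W" using wv Wc(3,5) by auto
    then have "inv\<^bsub>K\<^esub> (c \<ominus>\<^bsub>K\<^esub> d) \<odot>\<^bsub>A\<^esub> ((c \<ominus>\<^bsub>K\<^esub> d) \<odot>\<^bsub>A\<^esub> a) \<in> W"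
      using unit[OF n(2,1)] Wc(4) by blast
    then have "a \<in> W"
      using unit[OF n(2,1)] n assms(4) by (simp add: A.smult_assoc1[symmetric])
    then show False using W(3) by simp
  qed
  define \<phi> where "\<phi> x = (THE c. c \<in> carrier K \<and> (\<exists>w\<in>W. x = w \<oplus>\<^bsub>A\<^esub> c \<odot>\<^bsub>A\<^esub> a))" for x
  have \<phi>: "\<phi> (w \<oplus>\<^bsub>A\<^esub> c \<odot>\<^bsub>A\<^esub> a) = c" if "c \<in> carrier K" "w \<in> W" for c w
    unfolding \<phi>_def using that by (intro the_equality) (auto dest: uniq)
  show thesis
  proof (rule that[of \<phi>])
    show "linear_map K A (ground_module K) \<phi>"
    proof (rule linear_mapI)
      fix x assume "x \<in> carrier A"
      then show "\<phi> x \<in> carrier (ground_module K)"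
        using ex \<phi> by (fastforce simp: ground_module_def)
    next
      fix x y assume "x \<in> carrier A" "y \<in> carrier A"
      then obtain w c w' c' where x: "x = w \<oplus>\<^bsub>A\<^esub> c \<odot>\<^bsub>A\<^esub> a" "w \<in> W" "c \<in> carrier K"
        and y: "y = w' \<oplus>\<^bsub>A\<^esub> c' \<odot>\<^bsub>A\<^esub> a" "w' \<in> W" "c' \<in> carrier K" using ex by meson
      then have "x \<oplus>\<^bsub>A\<^esub> y = (w \<oplus>\<^bsub>A\<^esub> w') \<oplus>\<^bsub>A\<^esub> (c \<oplus>\<^bsub>K\<^esub> c') \<odot>\<^bsub>A\<^esub> a"
        using assms(4) Wsub by (simp add: A.smult_l_distr A.M.a_ac)
      then show "\<phi> (x \<oplus>\<^bsub>A\<^esub> y) = \<phi> x \<oplus>\<^bsub>ground_module K\<^esub> \<phi> y"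
        using x y Wc(5) by (simp add: \<phi> ground_module_def)
    next
      fix d x assume d: "d \<in> carrier K" and "x \<in> carrier A"
      then obtain w c where x: "x = w \<oplus>\<^bsub>A\<^esub> c \<odot>\<^bsub>A\<^esub> a" "w \<in> W" "c \<in> carrier K" using ex by meson
      then have "d \<odot>\<^bsub>A\<^esub> x = d \<odot>\<^bsub>A\<^esub> w \<oplus>\<^bsub>A\<^esub> (d \<otimes>\<^bsub>K\<^esub> c) \<odot>\<^bsub>A\<^esub> a"
        using assms(4) d Wsub by (simp add: A.smult_r_distr A.smult_assoc1)
      then show "\<phi> (d \<odot>\<^bsub>A\<^esub> x) = d \<odot>\<^bsub>ground_module K\<^esub> \<phi> x"
        using x d Wc(4) by (simp add: \<phi> ground_module_def)
    qed
  next
    fix x assume "x \<in> U"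
    then have "x \<in> W" using W(2) by auto
    then show "\<phi> x = \<zero>\<^bsub>K\<^esub>" using \<phi>[of "\<zero>\<^bsub>K\<^esub>" x] Wsub assms(4) by simp
  next
    show "\<phi> a = \<one>\<^bsub>K\<^esub>" using \<phi>[of "\<one>\<^bsub>K\<^esub>" "\<zero>\<^bsub>A\<^esub>"] W0 assms(4) by simp
  qed
qed

text \<open>
  Fixing the second factors makes this set of sums \<open>\<Sum> m\<^sub>i \<otimes> a\<^sub>i\<close> closed under addition, so that
  a term whose second factor depends on the others can be absorbed without lengthening the list.
\<close>

primrec tensor_sums ::
  "('k, 'r) ring_scheme \<Rightarrow> ('k, 'v, 'm) module_scheme \<Rightarrow> ('k, 'w, 'n) module_scheme \<Rightarrow>
   'w list \<Rightarrow> ('v \<times> 'w \<Rightarrow> 'k) set set" where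
  "tensor_sums K M A [] = {\<zero>\<^bsub>M \<boxtimes>\<^bsub>K\<^esub> A\<^esub>}"
| "tensor_sums K M A (a # as) =
    {pure_tensor K M A m a \<oplus>\<^bsub>M \<boxtimes>\<^bsub>K\<^esub> A\<^esub> t | m t. m \<in> carrier M \<and> t \<in> tensor_sums K M A as}"

context
  fixes K :: "('k, 'r) ring_scheme"
    and M :: "('k, 'v, 'm) module_scheme" and A :: "('k, 'a, 'n) module_scheme"
  assumes M: "module K M" and A: "module K A"
begin

interpretation M: module K M by (rule M)
interpretation A: module K A by (rule A)
interpretation T: module K "M \<boxtimes>\<^bsub>K\<^esub> A" by (rule tensor_module[OF M A])

lemma tensor_sums_carrier:
  "set as \<subseteq> carrier A \<Longrightarrow> tensor_sums K M A as \<subseteq> carrier (M \<boxtimes>\<^bsub>K\<^esub> A)"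
  by (induction as) (auto intro!: T.M.add.m_closed pure_tensor_closed M)

lemma tensor_sums_zero: "set as \<subseteq> carrier A \<Longrightarrow> \<zero>\<^bsub>M \<boxtimes>\<^bsub>K\<^esub> A\<^esub> \<in> tensor_sums K M A as"
proof (induction as)
  case (Cons a as)
  then have "pure_tensor K M A \<zero>\<^bsub>M\<^esub> a = \<zero>\<^bsub>M \<boxtimes>\<^bsub>K\<^esub> A\<^esub>"
    using linear_map_zero[OF M tensor_module[OF M A] pure_tensor_linear_left[OF M A]] by simp
  with Cons show ?case
    by (auto intro!: exI[of _ "\<zero>\<^bsub>M\<^esub>"] exI[of _ "\<zero>\<^bsub>M \<boxtimes>\<^bsub>K\<^esub> A\<^esub>"])
qed simp

lemma tensor_sums_add:
  "set as \<subseteq> carrier A \<Longrightarrow> s \<in> tensor_sums K M A as \<Longrightarrow> t \<in> tensor_sums K M A as \<Longrightarrow>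
    s \<oplus>\<^bsub>M \<boxtimes>\<^bsub>K\<^esub> A\<^esub> t \<in> tensor_sums K M A as"
proof (induction as arbitrary: s t)
  case (Cons a as)
  obtain m s' where s: "s = pure_tensor K M A m a \<oplus>\<^bsub>M \<boxtimes>\<^bsub>K\<^esub> A\<^esub> s'" "m \<in> carrier M" "s' \<in> tensor_sums K M A as"
    using Cons.prems(2) by auto
  obtain n t' where t: "t = pure_tensor K M A n a \<oplus>\<^bsub>M \<boxtimes>\<^bsub>K\<^esub> A\<^esub> t'" "n \<in> carrier M" "t' \<in> tensor_sums K M A as"
    using Cons.prems(3) by auto
  have a: "a \<in> carrier A" and as: "set as \<subseteq> carrier A" using Cons.prems(1) by auto
  have c: "s' \<in> carrier (M \<boxtimes>\<^bsub>K\<^esub> A)" "t' \<in> carrier (M \<boxtimes>\<^bsub>K\<^esub> A)"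
    using tensor_sums_carrier[OF as] s t by auto
  have "s \<oplus>\<^bsub>M \<boxtimes>\<^bsub>K\<^esub> A\<^esub> t = pure_tensor K M A (m \<oplus>\<^bsub>M\<^esub> n) a \<oplus>\<^bsub>M \<boxtimes>\<^bsub>K\<^esub> A\<^esub> (s' \<oplus>\<^bsub>M \<boxtimes>\<^bsub>K\<^esub> A\<^esub> t')"
    unfolding s(1) t(1) linear_map_add[OF pure_tensor_linear_left[OF M A a] s(2) t(2)]
    using c s(2) t(2) a by (simp add: T.M.a_ac pure_tensor_closed[OF M])
  then show ?case
    using Cons.IH[OF as s(3) t(3)] s(2) t(2) by auto
qed simp

lemma tensor_sums_append:
  assumes "set as \<subseteq> carrier A" "set bs \<subseteq> carrier A"
    "s \<in> tensor_sums K M A as" "t \<in> tensor_sums K M A bs"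
  shows "s \<oplus>\<^bsub>M \<boxtimes>\<^bsub>K\<^esub> A\<^esub> t \<in> tensor_sums K M A (as @ bs)"
  using assms
proof (induction as arbitrary: s)
  case Nil
  then have "t \<in> carrier (M \<boxtimes>\<^bsub>K\<^esub> A)" using tensor_sums_carrier[OF assms(2)] by blast
  then show ?case using Nil by simp
next
  case (Cons a as)
  obtain m s' where s: "s = pure_tensor K M A m a \<oplus>\<^bsub>M \<boxtimes>\<^bsub>K\<^esub> A\<^esub> s'" "m \<in> carrier M" "s' \<in> tensor_sums K M A as"
    using Cons.prems(3) by auto
  have a: "a \<in> carrier A" and as: "set as \<subseteq> carrier A" using Cons.prems(1) by auto
  have c: "s' \<in> carrier (M \<boxtimes>\<^bsub>K\<^esub> A)" "t \<in> carrier (M \<boxtimes>\<^bsub>K\<^esub> A)"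
    using tensor_sums_carrier[OF as] tensor_sums_carrier[OF assms(2)] s Cons.prems(4) by auto
  have "s \<oplus>\<^bsub>M \<boxtimes>\<^bsub>K\<^esub> A\<^esub> t = pure_tensor K M A m a \<oplus>\<^bsub>M \<boxtimes>\<^bsub>K\<^esub> A\<^esub> (s' \<oplus>\<^bsub>M \<boxtimes>\<^bsub>K\<^esub> A\<^esub> t)"
    unfolding s(1) using c s(2) a by (simp add: T.M.a_assoc pure_tensor_closed[OF M])
  then show ?case
    using Cons.IH[OF as assms(2) s(3) Cons.prems(4)] s(2) by auto
qed

lemma pure_tensor_in_tensor_sums:
  "set as \<subseteq> carrier A \<Longrightarrow> a \<in> set as \<Longrightarrow> m \<in> carrier M \<Longrightarrow> pure_tensor K M A m a \<in> tensor_sums K M A as"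
proof (induction as)
  case (Cons b as)
  have b: "b \<in> carrier A" and as: "set as \<subseteq> carrier A" using Cons.prems(1) by auto
  show ?case
  proof (cases "a = b")
    case True
    then have "pure_tensor K M A m a = pure_tensor K M A m b \<oplus>\<^bsub>M \<boxtimes>\<^bsub>K\<^esub> A\<^esub> \<zero>\<^bsub>M \<boxtimes>\<^bsub>K\<^esub> A\<^esub>"
      using b Cons.prems(3) by (simp add: pure_tensor_closed[OF M])
    then show ?thesis using tensor_sums_zero[OF as] Cons.prems(3) by auto
  next
    case False
    then have p: "pure_tensor K M A m a \<in> tensor_sums K M A as" using Cons as by auto
    have "pure_tensor K M A \<zero>\<^bsub>M\<^esub> b = \<zero>\<^bsub>M \<boxtimes>\<^bsub>K\<^esub> A\<^esub>"
      using linear_map_zero[OF M tensor_module[OF M A] pure_tensor_linear_left[OF M A b]] by simp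
    then have "pure_tensor K M A m a = pure_tensor K M A \<zero>\<^bsub>M\<^esub> b \<oplus>\<^bsub>M \<boxtimes>\<^bsub>K\<^esub> A\<^esub> pure_tensor K M A m a"
      using p tensor_sums_carrier[OF as] by auto
    then show ?thesis
      using p by (auto intro!: exI[of _ "\<zero>\<^bsub>M\<^esub>"] exI[of _ "pure_tensor K M A m a"])
  qed
qed simp

lemma tensor_sums_exhaust:
  assumes "t \<in> carrier (M \<boxtimes>\<^bsub>K\<^esub> A)"
  shows "\<exists>as. set as \<subseteq> carrier A \<and> t \<in> tensor_sums K M A as"
  using M A assms
proof (induction rule: tensor_induct)
  case zero
  show ?case by (rule exI[of _ "[]"]) simp
next
  case (pure m a)
  then show ?case
    using pure_tensor_in_tensor_sums[of "[a]" a m] by (intro exI[of _ "[a]"]) simp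
next
  case (add s t)
  then obtain as bs where "set as \<subseteq> carrier A" "s \<in> tensor_sums K M A as"
    "set bs \<subseteq> carrier A" "t \<in> tensor_sums K M A bs" by blast
  then show ?case
    using tensor_sums_append by (intro exI[of _ "as @ bs"]) simp
qed

text \<open>
  This submodule contains the entries of the list, and so their span. A functional vanishing on
  it isolates the coefficient of a further second factor.
\<close>

lemma tensor_sums_second_factors_submodule:
  assumes as: "set as \<subseteq> carrier A"
  shows "submodule {x \<in> carrier A. \<forall>m\<in>carrier M. pure_tensor K M A m x \<in> tensor_sums K M A as} K A"
proof (rule A.submoduleI)
  note R = pure_tensor_linear_right[OF M A]
  note TM = tensor_module[OF M A]
  show "\<zero>\<^bsub>A\<^esub> \<in> {x \<in> carrier A. \<forall>m\<in>carrier M. pure_tensor K M A m x \<in> tensor_sums K M A as}"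
    using tensor_sums_zero[OF as] by (simp add: linear_map_zero[OF A TM R])
next
  note R = pure_tensor_linear_right[OF M A] and L = pure_tensor_linear_left[OF M A]
  note TM = tensor_module[OF M A]
  fix x assume x: "x \<in> {x \<in> carrier A. \<forall>m\<in>carrier M. pure_tensor K M A m x \<in> tensor_sums K M A as}"
  have "pure_tensor K M A m (\<ominus>\<^bsub>A\<^esub> x) = pure_tensor K M A (\<ominus>\<^bsub>M\<^esub> m) x" if "m \<in> carrier M" for m
    using that x by (simp add: linear_map_a_inv[OF A TM R] linear_map_a_inv[OF M TM L])
  then show "\<ominus>\<^bsub>A\<^esub> x \<in> {x \<in> carrier A. \<forall>m\<in>carrier M. pure_tensor K M A m x \<in> tensor_sums K M A as}"
    using x by simp
next
  fix x y
  assume "x \<in> {x \<in> carrier A. \<forall>m\<in>carrier M. pure_tensor K M A m x \<in> tensor_sums K M A as}"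
    and "y \<in> {x \<in> carrier A. \<forall>m\<in>carrier M. pure_tensor K M A m x \<in> tensor_sums K M A as}"
  then show "x \<oplus>\<^bsub>A\<^esub> y \<in> {x \<in> carrier A. \<forall>m\<in>carrier M. pure_tensor K M A m x \<in> tensor_sums K M A as}"
    using tensor_sums_add[OF as] by (simp add: linear_map_add[OF pure_tensor_linear_right[OF M A]])
next
  note R = pure_tensor_linear_right[OF M A] and L = pure_tensor_linear_left[OF M A]
  fix c x assume c: "c \<in> carrier K"
    and x: "x \<in> {x \<in> carrier A. \<forall>m\<in>carrier M. pure_tensor K M A m x \<in> tensor_sums K M A as}"
  have "pure_tensor K M A m (c \<odot>\<^bsub>A\<^esub> x) = pure_tensor K M A (c \<odot>\<^bsub>M\<^esub> m) x" if "m \<in> carrier M" for m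
    using that c x by (simp add: linear_map_smult[OF R] linear_map_smult[OF L])
  then show "c \<odot>\<^bsub>A\<^esub> x \<in> {x \<in> carrier A. \<forall>m\<in>carrier M. pure_tensor K M A m x \<in> tensor_sums K M A as}"
    using c x by simp
qed auto

end

text \<open>
  This is what allows reading off the coefficient of one second factor: after contraction with a
  suitable functional the other terms contribute nothing.
\<close>

lemma contract_tensor_sums:
  assumes M: "module K M" and A: "module K A" and N: "module K N"
    and f: "linear_map K M N f" and \<phi>: "linear_map K A (ground_module K) \<phi>"
    and as: "set as \<subseteq> carrier A" "\<And>a. a \<in> set as \<Longrightarrow> \<phi> a = \<zero>\<^bsub>K\<^esub>"
    and t: "t \<in> tensor_sums K M A as"
  shows "tensor_lift K N (\<lambda>n a. \<phi> a \<odot>\<^bsub>N\<^esub> n) (tensor_map K N A f id t) = \<zero>\<^bsub>N\<^esub>"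
proof -
  interpret M: module K M by fact
  interpret N: module K N by fact
  note B = bilinear_scale_right[OF N A \<phi>] and F = tensor_map_linear[OF M A N A f linear_map_id]
  define h where "h t = tensor_lift K N (\<lambda>n a. \<phi> a \<odot>\<^bsub>N\<^esub> n) (tensor_map K N A f id t)" for t
  have G: "linear_map K (M \<boxtimes>\<^bsub>K\<^esub> A) N h"
    unfolding h_def by (rule linear_map_comp[OF F tensor_lift_linear[OF N A N B]])
  have ev: "h (pure_tensor K M A m a) = \<phi> a \<odot>\<^bsub>N\<^esub> f m"
    if "m \<in> carrier M" "a \<in> carrier A" for m a
    using that linear_map_closed[OF f]
    by (simp add: h_def tensor_map_pure[OF M A N A f linear_map_id] tensor_lift_pure[OF N A N B])
  have "h t = \<zero>\<^bsub>N\<^esub>"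
    using as t
  proof (induction as arbitrary: t)
    case Nil
    then show ?case using linear_map_zero[OF tensor_module[OF M A] N G] by simp
  next
    case (Cons a as)
    then obtain m s where t: "t = pure_tensor K M A m a \<oplus>\<^bsub>M \<boxtimes>\<^bsub>K\<^esub> A\<^esub> s" "m \<in> carrier M"
      "s \<in> tensor_sums K M A as" by auto
    have "s \<in> carrier (M \<boxtimes>\<^bsub>K\<^esub> A)" using tensor_sums_carrier[OF M A] Cons.prems(1) t(3) by auto
    moreover have "h s = \<zero>\<^bsub>N\<^esub>"
      using Cons t(3) by simp
    ultimately show ?case
      using Cons.prems(1,2) t(2) linear_map_closed[OF f]
      by (simp add: t(1) linear_map_add[OF G] ev pure_tensor_closed[OF M])
  qed
  then show ?thesis by (simp add: h_def)
qed

text \<open>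
  Exactness of tensoring with \<open>A\<close>. By induction on the number of terms of \<open>t = \<Sum> m\<^sub>i \<otimes> a\<^sub>i\<close>: if one of the
  second factors, \<open>a\<close>, depends on the others, its term can be distributed over theirs. Otherwise there
  is a functional with value \<open>1\<close> at \<open>a\<close> that vanishes at the other second factors; applying it to
  both sides of the assumed equation yields \<open>f m = g m\<close> for the coefficient \<open>m\<close> of \<open>a\<close>, and
  \<open>m \<otimes> a\<close> can be split off.
\<close>

lemma tensor_equalizer:
  assumes K: "field K" and M: "module K M" and A: "module K A" and N: "module K N"
    and f: "linear_map K M N f" and g: "linear_map K M N g"
    and t: "t \<in> carrier (M \<boxtimes>\<^bsub>K\<^esub> A)" and eq: "tensor_map K N A f id t = tensor_map K N A g id t"
  shows "t \<in> tensor_map K M A id id ` carrier (subspace_module M {m \<in> carrier M. f m = g m} \<boxtimes>\<^bsub>K\<^esub> A)"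
proof -
  let ?E = "{m \<in> carrier M. f m = g m}"
  define I where "I = tensor_map K M A id id ` carrier (subspace_module M ?E \<boxtimes>\<^bsub>K\<^esub> A)"
  define F where "F = tensor_map K N A f id"
  define G where "G = tensor_map K N A g id"
  interpret M: module K M by fact
  interpret N: module K N by fact
  interpret T: module K "M \<boxtimes>\<^bsub>K\<^esub> A" by (rule tensor_module[OF M A])
  interpret TN: module K "N \<boxtimes>\<^bsub>K\<^esub> A" by (rule tensor_module[OF N A])
  have subE: "submodule ?E K M" by (rule equalizer_submodule[OF M N f g])
  have E: "module K (subspace_module M ?E)" by (rule submodule.submodule_is_module[OF subE M])
  note TE = tensor_module[OF E A] and M' = tensor_module[OF M A]
  note i = submodule_linear_id[OF subE M]
  note incl = tensor_map_linear[OF E A M A i linear_map_id]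
  note I_zero = linear_map_image_zero[OF TE M' incl, folded I_def]
    and I_add = linear_map_image_add[OF TE incl, folded I_def]
  have I_pure: "pure_tensor K M A m a \<in> I" if "m \<in> ?E" "a \<in> carrier A" for m a
    unfolding I_def
  proof (rule image_eqI)
    show "pure_tensor K M A m a = tensor_map K M A id id (pure_tensor K (subspace_module M ?E) A m a)"
      using that by (subst tensor_map_pure[OF E A M A i linear_map_id]) auto
  qed (use that in \<open>auto intro!: pure_tensor_closed E\<close>)
  note F = tensor_map_linear[OF M A N A f linear_map_id, folded F_def]
    and G = tensor_map_linear[OF M A N A g linear_map_id, folded G_def]
  note ev = tensor_map_pure[OF M A N A f linear_map_id, folded F_def]
    tensor_map_pure[OF M A N A g linear_map_id, folded G_def]
  have "t \<in> I"
    if "set as \<subseteq> carrier A" "t \<in> tensor_sums K M A as"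
      "F t = G t" for as t
    using that
  proof (induction as arbitrary: t)
    case Nil
    then show ?case using I_zero by simp
  next
    case (Cons a as)
    have a: "a \<in> carrier A" and as: "set as \<subseteq> carrier A" using Cons.prems(1) by auto
    obtain m s where t: "t = pure_tensor K M A m a \<oplus>\<^bsub>M \<boxtimes>\<^bsub>K\<^esub> A\<^esub> s" and m: "m \<in> carrier M"
      and s: "s \<in> tensor_sums K M A as" using Cons.prems(2) by auto
    have sc: "s \<in> carrier (M \<boxtimes>\<^bsub>K\<^esub> A)" using tensor_sums_carrier[OF M A as] s by auto
    let ?B = "{x \<in> carrier A. \<forall>m\<in>carrier M. pure_tensor K M A m x \<in> tensor_sums K M A as}"
    show ?case
    proof (cases "a \<in> ?B")
      case True
      then have "t \<in> tensor_sums K M A as"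
        unfolding t using m s by (intro tensor_sums_add[OF M A as]) auto
      then show ?thesis using Cons.IH[OF as] Cons.prems(3) by blast
    next
      case False
      obtain \<phi> where \<phi>: "linear_map K A (ground_module K) \<phi>" "\<And>x. x \<in> ?B \<Longrightarrow> \<phi> x = \<zero>\<^bsub>K\<^esub>" "\<phi> a = \<one>\<^bsub>K\<^esub>"
        by (rule separating_functional[OF K A tensor_sums_second_factors_submodule[OF M A as] a False], rule that)
      \<comment> \<open>the entries of the list lie in the submodule on which \<open>\<phi>\<close> vanishes\<close>
      have \<phi>as: "\<phi> x = \<zero>\<^bsub>K\<^esub>" if "x \<in> set as" for x
        using that as pure_tensor_in_tensor_sums[OF M A as that] by (intro \<phi>(2)) auto
      note B = bilinear_scale_right[OF N A \<phi>(1)]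
      note C = tensor_lift_linear[OF N A N B]
      have contract: "tensor_lift K N (\<lambda>n a. \<phi> a \<odot>\<^bsub>N\<^esub> n) (tensor_map K N A h id t) = h m"
        if h: "linear_map K M N h" for h
      proof -
        note H = tensor_map_linear[OF M A N A h linear_map_id]
        show ?thesis
          using sc m a linear_map_closed[OF h m]
          by (simp add: t linear_map_add[OF linear_map_comp[OF H C]] pure_tensor_closed[OF M]
              contract_tensor_sums[OF M A N h \<phi>(1) as \<phi>as s]
              tensor_map_pure[OF M A N A h linear_map_id] tensor_lift_pure[OF N A N B] \<phi>(3))
      qed
      have fg: "f m = g m" using contract[OF f, folded F_def] contract[OF g, folded G_def] Cons.prems(3) by simp
      have cl: "F s \<in> carrier (N \<boxtimes>\<^bsub>K\<^esub> A)" "G s \<in> carrier (N \<boxtimes>\<^bsub>K\<^esub> A)"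
        "pure_tensor K N A (g m) a \<in> carrier (N \<boxtimes>\<^bsub>K\<^esub> A)"
        using sc m a linear_map_closed[OF F] linear_map_closed[OF G] linear_map_closed[OF g]
        by (auto intro!: pure_tensor_closed N)
      have "pure_tensor K N A (g m) a \<oplus>\<^bsub>N \<boxtimes>\<^bsub>K\<^esub> A\<^esub> F s
          = pure_tensor K N A (g m) a \<oplus>\<^bsub>N \<boxtimes>\<^bsub>K\<^esub> A\<^esub> G s"
        using Cons.prems(3) m a sc unfolding t
        by (simp add: linear_map_add[OF F] linear_map_add[OF G] pure_tensor_closed[OF M] ev fg)
      then have "F s = G s"
        using cl by simp
      then have "s \<in> I" using Cons.IH[OF as s] by blast
      then show ?thesis unfolding t using fg m a by (intro I_add I_pure) auto
    qed
  qed
  then show ?thesis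
    using tensor_sums_exhaust[OF M A t] eq unfolding I_def F_def G_def by blast
qed

text \<open>
  The kernel of \<open>h \<otimes> id\<close> is the equalizer of \<open>h \<otimes> id\<close> and \<open>0 \<otimes> id\<close>, hence comes from
  \<open>ker h \<otimes> A\<close>, and \<open>ker h = 0\<close>.
\<close>

lemma tensor_map_inj_on:
  assumes K: "field K" and M: "module K M" and A: "module K A" and N: "module K N"
    and h: "linear_map K M N h" and inj: "inj_on h (carrier M)"
  shows "inj_on (tensor_map K N A h id) (carrier (M \<boxtimes>\<^bsub>K\<^esub> A))"
proof (rule inj_onI)
  fix x y assume x: "x \<in> carrier (M \<boxtimes>\<^bsub>K\<^esub> A)" and y: "y \<in> carrier (M \<boxtimes>\<^bsub>K\<^esub> A)"
    and eq: "tensor_map K N A h id x = tensor_map K N A h id y"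
  interpret M: module K M by fact
  interpret N: module K N by fact
  note TM = tensor_module[OF M A] and TN = tensor_module[OF N A]
  interpret T: module K "M \<boxtimes>\<^bsub>K\<^esub> A" by (rule TM)
  interpret TN: module K "N \<boxtimes>\<^bsub>K\<^esub> A" by (rule TN)
  let ?z = "\<lambda>_. \<zero>\<^bsub>N\<^esub>"
  let ?d = "x \<ominus>\<^bsub>M \<boxtimes>\<^bsub>K\<^esub> A\<^esub> y"
  let ?E = "{m \<in> carrier M. h m = \<zero>\<^bsub>N\<^esub>}"
  note H = tensor_map_linear[OF M A N A h linear_map_id]
  note z = linear_map_const_zero[OF M N]
  have d: "?d \<in> carrier (M \<boxtimes>\<^bsub>K\<^esub> A)" using x y by simp
  have "tensor_map K N A h id ?d = \<zero>\<^bsub>N \<boxtimes>\<^bsub>K\<^esub> A\<^esub>"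
    using linear_map_closed[OF H y]
    by (simp add: linear_map_a_minus[OF TM TN H x y] eq a_minus_def[of "N \<boxtimes>\<^bsub>K\<^esub> A"] TN.M.r_neg)
  also have "\<dots> = tensor_map K N A ?z id ?d"
    by (rule tensor_ext[OF M A TN linear_map_const_zero[OF TM TN] tensor_map_linear[OF M A N A z linear_map_id] _ d])
      (simp add: tensor_map_pure[OF M A N A z linear_map_id] linear_map_zero[OF N TN pure_tensor_linear_left[OF N A]])
  finally have "?d \<in> tensor_map K M A id id ` carrier (subspace_module M ?E \<boxtimes>\<^bsub>K\<^esub> A)"
    by (rule tensor_equalizer[OF K M A N h z d])
  then obtain e where e: "e \<in> carrier (subspace_module M ?E \<boxtimes>\<^bsub>K\<^esub> A)" "?d = tensor_map K M A id id e"
    by blast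
  have E0: "m = \<zero>\<^bsub>M\<^esub>" if "m \<in> ?E" for m
    using that inj_onD[OF inj, of m "\<zero>\<^bsub>M\<^esub>"] linear_map_zero[OF M N h] by simp
  have subE: "submodule ?E K M" by (rule equalizer_submodule[OF M N h z])
  have E: "module K (subspace_module M ?E)" by (rule submodule.submodule_is_module[OF subE M])
  note i = submodule_linear_id[OF subE M]
  have "tensor_map K M A id id e = \<zero>\<^bsub>M \<boxtimes>\<^bsub>K\<^esub> A\<^esub>"
  proof (rule tensor_ext[OF E A TM tensor_map_linear[OF E A M A i linear_map_id]
        linear_map_const_zero[OF tensor_module[OF E A] TM] _ e(1)])
    fix m a assume m: "m \<in> carrier (subspace_module M ?E)" and a: "a \<in> carrier A"
    have "tensor_map K M A id id (pure_tensor K (subspace_module M ?E) A m a) = pure_tensor K M A \<zero>\<^bsub>M\<^esub> a"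
      using tensor_map_pure[OF E A M A i linear_map_id m a] E0 m by simp
    then show "tensor_map K M A id id (pure_tensor K (subspace_module M ?E) A m a) = \<zero>\<^bsub>M \<boxtimes>\<^bsub>K\<^esub> A\<^esub>"
      using linear_map_zero[OF M TM pure_tensor_linear_left[OF M A a]] by simp
  qed
  then have "?d = \<zero>\<^bsub>M \<boxtimes>\<^bsub>K\<^esub> A\<^esub>" using e(2) by simp
  then have "(x \<ominus>\<^bsub>M \<boxtimes>\<^bsub>K\<^esub> A\<^esub> y) \<oplus>\<^bsub>M \<boxtimes>\<^bsub>K\<^esub> A\<^esub> y = y" using y by simp
  then show "x = y" using x y by (simp add: a_minus_def T.M.a_assoc T.M.l_neg)
qed

section \<open>Restricting a corepresentation to an invariant subspace\<close>

text \<open>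
  The definite description has a witness by the assumption of invariance, and only one because the
  inclusion \<open>W \<otimes> A \<rightarrow> M \<otimes> A\<close> is injective.
\<close>

lemma restricted_coaction_props:
  assumes K: "field K" and M: "module K M" and A: "module K A" and W: "submodule W K M"
    and inv: "\<And>w. w \<in> W \<Longrightarrow> \<delta> w \<in> tensor_map K M A id id ` carrier (subspace_module M W \<boxtimes>\<^bsub>K\<^esub> A)"
    and w: "w \<in> W"
  shows "restricted_coaction K A M W \<delta> w \<in> carrier (subspace_module M W \<boxtimes>\<^bsub>K\<^esub> A)"
    and "tensor_map K M A id id (restricted_coaction K A M W \<delta> w) = \<delta> w"
proof -
  have S: "module K (subspace_module M W)" by (rule submodule.submodule_is_module[OF W M])
  have "inj_on (tensor_map K M A id id) (carrier (subspace_module M W \<boxtimes>\<^bsub>K\<^esub> A))"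
    by (rule tensor_map_inj_on[OF K S A M submodule_linear_id[OF W M]]) simp
  then have "\<exists>!y. y \<in> carrier (subspace_module M W \<boxtimes>\<^bsub>K\<^esub> A) \<and> tensor_map K M A id id y = \<delta> w"
    using inv[OF w] by (auto dest: inj_onD)
  from theI'[OF this]
  show "restricted_coaction K A M W \<delta> w \<in> carrier (subspace_module M W \<boxtimes>\<^bsub>K\<^esub> A)"
    and "tensor_map K M A id id (restricted_coaction K A M W \<delta> w) = \<delta> w"
    by (simp_all add: restricted_coaction_def)
qed

text \<open>
  Each axiom holds after applying the appropriate inclusion: \<open>W \<otimes> A \<rightarrow> M \<otimes> A\<close> for linearity,
  \<open>(W \<otimes> A) \<otimes> A \<rightarrow> (M \<otimes> A) \<otimes> A\<close> for coassociativity and \<open>W \<rightarrow> M\<close> for the counit. All three are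
  injective, the second by applying \<open>tensor_map_inj_on\<close> twice.
\<close>

lemma right_corepresentation_restrict:
  assumes K: "field K" and A: "coalgebra K A" and \<delta>: "right_corepresentation K A M \<delta>"
    and W: "submodule W K M"
    and inv: "\<And>w. w \<in> W \<Longrightarrow> \<delta> w \<in> tensor_map K M A id id ` carrier (subspace_module M W \<boxtimes>\<^bsub>K\<^esub> A)"
  shows "right_corepresentation K A (subspace_module M W) (restricted_coaction K A M W \<delta>)"
proof -
  interpret A: coalgebra K A by fact
  define S where "S = subspace_module M W"
  define r where "r = restricted_coaction K A M W \<delta>"
  define \<iota> where "\<iota> = tensor_map K M A id id"
  have M: "module K M" and \<delta>_lin: "linear_map K M (M \<boxtimes>\<^bsub>K\<^esub> A) \<delta>"
    and \<delta>_coassoc: "\<And>v. v \<in> carrier M \<Longrightarrow> tensor_map K (M \<boxtimes>\<^bsub>K\<^esub> A) A \<delta> id (\<delta> v) =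
        assoc_left K M A A (tensor_map K M (A \<boxtimes>\<^bsub>K\<^esub> A) id (comult A) (\<delta> v))"
    and \<delta>_counit: "\<And>v. v \<in> carrier M \<Longrightarrow> tensor_lift K M (\<lambda>x c. counit A c \<odot>\<^bsub>M\<^esub> x) (\<delta> v) = v"
    using \<delta> by (auto simp: right_corepresentation_def)
  have Am: "module K A" by (rule A.module_axioms)
  have S: "module K S" unfolding S_def by (rule submodule.submodule_is_module[OF W M])
  note id_lin = submodule_linear_id[OF W M, folded S_def]
  have WM: "w \<in> W \<Longrightarrow> w \<in> carrier M" for w using module.submoduleE(1)[OF M W] by auto
  have S_simps: "carrier S = W" "add S = add M" "smult S = smult M" by (simp_all add: S_def)
  note MA = tensor_module[OF M Am] and SA = tensor_module[OF S Am] and AA = tensor_module[OF Am Am]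
  have r_props: "r w \<in> carrier (S \<boxtimes>\<^bsub>K\<^esub> A)" "\<iota> (r w) = \<delta> w" if w: "w \<in> W" for w
    unfolding r_def S_def \<iota>_def
    by (rule restricted_coaction_props[OF K M Am W _ w], rule inv, assumption)+
  note \<iota>_lin = tensor_map_linear[OF S Am M Am id_lin linear_map_id, folded \<iota>_def]
  have \<iota>_inj: "inj_on \<iota> (carrier (S \<boxtimes>\<^bsub>K\<^esub> A))"
    unfolding \<iota>_def by (rule tensor_map_inj_on[OF K S Am M id_lin]) simp
  interpret S: module K S by (rule S)
  interpret M: module K M by (rule M)
  interpret SA: module K "S \<boxtimes>\<^bsub>K\<^esub> A" by (rule SA)
  have r_lin: "linear_map K S (S \<boxtimes>\<^bsub>K\<^esub> A) r"
  proof (rule linear_mapI)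
    fix x assume "x \<in> carrier S"
    then show "r x \<in> carrier (S \<boxtimes>\<^bsub>K\<^esub> A)" using r_props(1) by (simp add: S_simps)
  next
    fix x y assume x: "x \<in> carrier S" and y: "y \<in> carrier S"
    then have xy: "x \<in> W" "y \<in> W" "x \<oplus>\<^bsub>M\<^esub> y \<in> W"
      using S.M.a_closed[OF x y] by (simp_all add: S_simps)
    have "\<iota> (r (x \<oplus>\<^bsub>M\<^esub> y)) = \<iota> (r x \<oplus>\<^bsub>S \<boxtimes>\<^bsub>K\<^esub> A\<^esub> r y)"
      using xy WM by (simp add: r_props linear_map_add[OF \<iota>_lin] linear_map_add[OF \<delta>_lin])
    then have "r (x \<oplus>\<^bsub>M\<^esub> y) = r x \<oplus>\<^bsub>S \<boxtimes>\<^bsub>K\<^esub> A\<^esub> r y"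
      by (rule inj_onD[OF \<iota>_inj]) (use xy r_props(1) in auto)
    then show "r (x \<oplus>\<^bsub>S\<^esub> y) = r x \<oplus>\<^bsub>S \<boxtimes>\<^bsub>K\<^esub> A\<^esub> r y" by (simp add: S_simps)
  next
    fix c x assume c: "c \<in> carrier K" and x: "x \<in> carrier S"
    then have cx: "x \<in> W" "c \<odot>\<^bsub>M\<^esub> x \<in> W"
      using S.smult_closed[OF c x] by (simp_all add: S_simps)
    have "\<iota> (r (c \<odot>\<^bsub>M\<^esub> x)) = \<iota> (c \<odot>\<^bsub>S \<boxtimes>\<^bsub>K\<^esub> A\<^esub> r x)"
      using c cx WM by (simp add: r_props linear_map_smult[OF \<iota>_lin] linear_map_smult[OF \<delta>_lin])
    then have "r (c \<odot>\<^bsub>M\<^esub> x) = c \<odot>\<^bsub>S \<boxtimes>\<^bsub>K\<^esub> A\<^esub> r x"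
      by (rule inj_onD[OF \<iota>_inj]) (use c cx r_props(1) in auto)
    then show "r (c \<odot>\<^bsub>S\<^esub> x) = c \<odot>\<^bsub>S \<boxtimes>\<^bsub>K\<^esub> A\<^esub> r x" by (simp add: S_simps)
  qed
  let ?J = "tensor_map K (M \<boxtimes>\<^bsub>K\<^esub> A) A \<iota> id"
  note \<Delta> = A.comult_linear
  have coassoc: "tensor_map K (S \<boxtimes>\<^bsub>K\<^esub> A) A r id (r v) =
      assoc_left K S A A (tensor_map K S (A \<boxtimes>\<^bsub>K\<^esub> A) id (comult A) (r v))" if v: "v \<in> W" for v
  proof (rule inj_onD[OF tensor_map_inj_on[OF K SA Am MA \<iota>_lin \<iota>_inj]])
    have rv: "r v \<in> carrier (S \<boxtimes>\<^bsub>K\<^esub> A)" and \<iota>r: "\<iota> (r v) = \<delta> v" using r_props v by auto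
    note t = tensor_map_closed[OF S Am S AA linear_map_id \<Delta> rv]
    show "tensor_map K (S \<boxtimes>\<^bsub>K\<^esub> A) A r id (r v) \<in> carrier ((S \<boxtimes>\<^bsub>K\<^esub> A) \<boxtimes>\<^bsub>K\<^esub> A)"
      by (rule tensor_map_closed[OF S Am SA Am r_lin linear_map_id rv])
    show "assoc_left K S A A (tensor_map K S (A \<boxtimes>\<^bsub>K\<^esub> A) id (comult A) (r v)) \<in> carrier ((S \<boxtimes>\<^bsub>K\<^esub> A) \<boxtimes>\<^bsub>K\<^esub> A)"
      by (rule assoc_left_closed[OF S Am Am t])
    have "?J (tensor_map K (S \<boxtimes>\<^bsub>K\<^esub> A) A r id (r v)) = tensor_map K (M \<boxtimes>\<^bsub>K\<^esub> A) A \<delta> id (r v)"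
      by (rule tensor_map_comp[OF S Am SA Am MA Am r_lin linear_map_id \<iota>_lin linear_map_id _ _ rv])
        (simp_all add: S_simps r_props)
    also have "\<dots> = tensor_map K (M \<boxtimes>\<^bsub>K\<^esub> A) A \<delta> id (\<iota> (r v))"
      unfolding \<iota>_def
      by (rule tensor_map_comp[OF S Am M Am MA Am id_lin linear_map_id \<delta>_lin linear_map_id _ _ rv, symmetric]) simp_all
    also have "\<dots> = assoc_left K M A A (tensor_map K M (A \<boxtimes>\<^bsub>K\<^esub> A) id (comult A) (\<iota> (r v)))"
      unfolding \<iota>r using WM[OF v] by (rule \<delta>_coassoc)
    also have "tensor_map K M (A \<boxtimes>\<^bsub>K\<^esub> A) id (comult A) (\<iota> (r v)) = tensor_map K M (A \<boxtimes>\<^bsub>K\<^esub> A) id (comult A) (r v)"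
      unfolding \<iota>_def
      by (rule tensor_map_comp[OF S Am M Am M AA id_lin linear_map_id linear_map_id \<Delta> _ _ rv]) simp_all
    also have "\<dots> = tensor_map K M (A \<boxtimes>\<^bsub>K\<^esub> A) id (tensor_map K A A id id) (tensor_map K S (A \<boxtimes>\<^bsub>K\<^esub> A) id (comult A) (r v))"
      by (rule tensor_map_comp[OF S Am S AA M AA linear_map_id \<Delta> id_lin
            tensor_map_linear[OF Am Am Am Am linear_map_id linear_map_id] _ _ rv, symmetric])
        (simp_all add: tensor_map_id[OF Am Am] linear_map_closed[OF \<Delta>])
    also have "assoc_left K M A A \<dots> = ?J (assoc_left K S A A (tensor_map K S (A \<boxtimes>\<^bsub>K\<^esub> A) id (comult A) (r v)))"
      unfolding \<iota>_def
      by (rule assoc_left_natural[OF S Am Am M Am Am id_lin linear_map_id linear_map_id t])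
    finally show "?J (tensor_map K (S \<boxtimes>\<^bsub>K\<^esub> A) A r id (r v)) =
      ?J (assoc_left K S A A (tensor_map K S (A \<boxtimes>\<^bsub>K\<^esub> A) id (comult A) (r v)))" .
  qed
  note BS = bilinear_scale_right[OF S Am A.counit_linear] and BM = bilinear_scale_right[OF M Am A.counit_linear]
  have counit: "tensor_lift K S (\<lambda>x c. counit A c \<odot>\<^bsub>S\<^esub> x) (r v) = v" if v: "v \<in> W" for v
  proof -
    have rv: "r v \<in> carrier (S \<boxtimes>\<^bsub>K\<^esub> A)" and \<iota>r: "\<iota> (r v) = \<delta> v" using r_props v by auto
    have "id (tensor_lift K S (\<lambda>x c. counit A c \<odot>\<^bsub>S\<^esub> x) (r v))
        = tensor_lift K M (\<lambda>x c. counit A c \<odot>\<^bsub>M\<^esub> x) (\<iota> (r v))"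
    proof (rule tensor_ext[OF S Am M linear_map_comp[OF tensor_lift_linear[OF S Am S BS] id_lin]
          linear_map_comp[OF \<iota>_lin tensor_lift_linear[OF M Am M BM]] _ rv])
      fix x c assume x: "x \<in> carrier S" and c: "c \<in> carrier A"
      show "id (tensor_lift K S (\<lambda>x c. counit A c \<odot>\<^bsub>S\<^esub> x) (pure_tensor K S A x c))
        = tensor_lift K M (\<lambda>x c. counit A c \<odot>\<^bsub>M\<^esub> x) (\<iota> (pure_tensor K S A x c))"
      proof -
        have "x \<in> carrier M" using x WM by (simp add: S_simps)
        then show ?thesis
          unfolding \<iota>_def using x c
          by (simp add: tensor_lift_pure[OF S Am S BS] tensor_lift_pure[OF M Am M BM]
              tensor_map_pure[OF S Am M Am id_lin linear_map_id], simp add: S_simps)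
      qed
    qed
    then show ?thesis using \<delta>_counit[OF WM[OF v]] \<iota>r by simp
  qed
  have "right_corepresentation K A S r"
    unfolding right_corepresentation_def using S r_lin coassoc counit by (auto simp: S_simps)
  then show ?thesis by (simp add: S_def r_def)
qed

section \<open>The cofree corepresentation\<close>

context
  fixes K :: "('k, 'r) ring_scheme"
    and A :: "('k, 'a, 'm) hopf_algebra_scheme"
    and V :: "('k, 'v, 'l) module_scheme"
  assumes A: "coalgebra K A" and V: "module K V"
begin

interpretation A: coalgebra K A by (rule A)

private lemma Am: "module K A" by (rule A.module_axioms)

private lemmas VA = tensor_module[OF V Am] and AA = tensor_module[OF Am Am]
  and \<Delta> = A.comult_linear

lemma id_tensor_comult_linear:
  "linear_map K (V \<boxtimes>\<^bsub>K\<^esub> A) ((V \<boxtimes>\<^bsub>K\<^esub> A) \<boxtimes>\<^bsub>K\<^esub> A) (id_tensor_comult K A V)"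
  unfolding id_tensor_comult_def
  by (rule linear_map_comp[OF tensor_map_linear[OF V Am V AA linear_map_id \<Delta>] assoc_left_linear[OF V Am Am]])

lemma id_tensor_comult_pure:
  "v \<in> carrier V \<Longrightarrow> a \<in> carrier A \<Longrightarrow>
    id_tensor_comult K A V (pure_tensor K V A v a) = assoc_left K V A A (pure_tensor K V (A \<boxtimes>\<^bsub>K\<^esub> A) v (comult A a))"
  by (simp add: id_tensor_comult_def tensor_map_pure[OF V Am V AA linear_map_id \<Delta>])

lemma id_tensor_comult_natural:
  assumes W: "module K W" and f: "linear_map K V W f" and F: "F \<in> carrier (V \<boxtimes>\<^bsub>K\<^esub> A)"
  shows "tensor_map K (W \<boxtimes>\<^bsub>K\<^esub> A) A (tensor_map K W A f id) id (id_tensor_comult K A V F)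
    = id_tensor_comult K A W (tensor_map K W A f id F)"
proof -
  note i = linear_map_id
  note t = tensor_map_closed[OF V Am V AA i \<Delta> F]
  note ii = tensor_map_linear[OF Am Am Am Am i i]
  have "id_tensor_comult K A W (tensor_map K W A f id F)
      = assoc_left K W A A (tensor_map K W (A \<boxtimes>\<^bsub>K\<^esub> A) f (comult A) F)"
    unfolding id_tensor_comult_def
    by (rule arg_cong[of _ _ "assoc_left K W A A"],
        rule tensor_map_comp[OF V Am W Am W AA f i i \<Delta> _ _ F]) simp_all
  also have "tensor_map K W (A \<boxtimes>\<^bsub>K\<^esub> A) f (comult A) F
      = tensor_map K W (A \<boxtimes>\<^bsub>K\<^esub> A) f (tensor_map K A A id id) (tensor_map K V (A \<boxtimes>\<^bsub>K\<^esub> A) id (comult A) F)"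
    by (rule tensor_map_comp[OF V Am V AA W AA i \<Delta> f ii _ _ F, symmetric])
      (simp_all add: tensor_map_id[OF Am Am] linear_map_closed[OF \<Delta>])
  also have "assoc_left K W A A \<dots>
      = tensor_map K (W \<boxtimes>\<^bsub>K\<^esub> A) A (tensor_map K W A f id) id (id_tensor_comult K A V F)"
    unfolding id_tensor_comult_def by (rule assoc_left_natural[OF V Am Am W Am Am f i i t])
  finally show ?thesis by (rule sym)
qed

end

text \<open>
  The hypothesis on \<open>L\<close> says \<open>(id \<otimes> \<Delta>) L = (L \<otimes> id) \<Delta>\<close>, and the conclusion is the same
  identity tensored with \<open>V\<close> on the left. With \<open>C = A\<close> and \<open>L = \<Delta>\<close> it is the coassociativity
  of \<open>id \<otimes> \<Delta>\<close>; with \<open>L = (\<pi> \<otimes> id) \<Delta>\<close> it makes the induced space invariant.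
\<close>

lemma id_tensor_comult_intertwines:
  assumes A: "coalgebra K A" and V: "module K V" and C: "module K C"
    and L: "linear_map K A (C \<boxtimes>\<^bsub>K\<^esub> A) L"
    and L_coaction: "\<And>a. a \<in> carrier A \<Longrightarrow>
      id_tensor_comult K A C (L a) = tensor_map K (C \<boxtimes>\<^bsub>K\<^esub> A) A L id (comult A a)"
    and F: "F \<in> carrier (V \<boxtimes>\<^bsub>K\<^esub> A)"
  shows "tensor_map K ((V \<boxtimes>\<^bsub>K\<^esub> C) \<boxtimes>\<^bsub>K\<^esub> A) A (\<lambda>F. assoc_left K V C A (tensor_map K V (C \<boxtimes>\<^bsub>K\<^esub> A) id L F)) id
      (id_tensor_comult K A V F)
    = id_tensor_comult K A (V \<boxtimes>\<^bsub>K\<^esub> C) (assoc_left K V C A (tensor_map K V (C \<boxtimes>\<^bsub>K\<^esub> A) id L F))"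
proof -
  interpret A: coalgebra K A by fact
  have Am: "module K A" by (rule A.module_axioms)
  note i = linear_map_id and \<Delta> = A.comult_linear
  note VC = tensor_module[OF V C] and CA = tensor_module[OF C Am] and AA = tensor_module[OF Am Am]
    and VA = tensor_module[OF V Am]
  note VCA = tensor_module[OF VC Am] and CAA = tensor_module[OF CA Am]
  define \<Lambda> where "\<Lambda> = (\<lambda>F. assoc_left K V C A (tensor_map K V (C \<boxtimes>\<^bsub>K\<^esub> A) id L F))"
  have \<Lambda>: "linear_map K (V \<boxtimes>\<^bsub>K\<^esub> A) ((V \<boxtimes>\<^bsub>K\<^esub> C) \<boxtimes>\<^bsub>K\<^esub> A) \<Lambda>"
    unfolding \<Lambda>_def
    by (rule linear_map_comp[OF tensor_map_linear[OF V Am V CA i L] assoc_left_linear[OF V C Am]])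
  note \<delta> = id_tensor_comult_linear[OF A V] and \<delta>VC = id_tensor_comult_linear[OF A VC]
    and \<delta>C = id_tensor_comult_linear[OF A C]
  note \<Lambda>i = tensor_map_linear[OF VA Am VCA Am \<Lambda> i]
  have "tensor_map K ((V \<boxtimes>\<^bsub>K\<^esub> C) \<boxtimes>\<^bsub>K\<^esub> A) A \<Lambda> id (id_tensor_comult K A V F)
    = id_tensor_comult K A (V \<boxtimes>\<^bsub>K\<^esub> C) (\<Lambda> F)"
  proof (rule tensor_ext[OF V Am tensor_module[OF VCA Am] linear_map_comp[OF \<delta> \<Lambda>i] linear_map_comp[OF \<Lambda> \<delta>VC] _ F])
    fix v a assume v: "v \<in> carrier V" and a: "a \<in> carrier A"
    \<comment> \<open>The embedding \<open>s \<mapsto> v \<otimes> s\<close> of \<open>C \<otimes> A\<close>, reassociated; both sides turn out to be \<open>(\<theta> \<otimes> id) (L \<otimes> id) \<Delta> a\<close>.\<close>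
    define \<theta> where "\<theta> s = assoc_left K V C A (pure_tensor K V (C \<boxtimes>\<^bsub>K\<^esub> A) v s)" for s
    have \<theta>: "linear_map K (C \<boxtimes>\<^bsub>K\<^esub> A) ((V \<boxtimes>\<^bsub>K\<^esub> C) \<boxtimes>\<^bsub>K\<^esub> A) \<theta>"
      unfolding \<theta>_def by (rule assoc_left_pure_linear[OF V C Am v])
    define \<Theta> where "\<Theta> = tensor_map K ((V \<boxtimes>\<^bsub>K\<^esub> C) \<boxtimes>\<^bsub>K\<^esub> A) A \<theta> id"
    note \<Theta> = tensor_map_linear[OF CA Am VCA Am \<theta> i, folded \<Theta>_def]
      and \<Theta>_pure = tensor_map_pure[OF CA Am VCA Am \<theta> i, folded \<Theta>_def]
    have \<Lambda>_pure: "\<Lambda> (pure_tensor K V A v x) = \<theta> (L x)" if "x \<in> carrier A" for x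
      using that v by (simp add: \<Lambda>_def \<theta>_def tensor_map_pure[OF V Am V CA i L])
    have \<theta>_pure: "\<theta> (pure_tensor K C A c x) = pure_tensor K (V \<boxtimes>\<^bsub>K\<^esub> C) A (pure_tensor K V C v c) x"
      if "c \<in> carrier C" "x \<in> carrier A" for c x
      using that v by (simp add: \<theta>_def assoc_left_pure[OF V C Am])
    \<comment> \<open>\<open>s\<close> stands for \<open>\<Delta> a\<close>, which is not pure.\<close>
    have 1: "tensor_map K ((V \<boxtimes>\<^bsub>K\<^esub> C) \<boxtimes>\<^bsub>K\<^esub> A) A \<Lambda> id (assoc_left K V A A (pure_tensor K V (A \<boxtimes>\<^bsub>K\<^esub> A) v s))
        = \<Theta> (tensor_map K (C \<boxtimes>\<^bsub>K\<^esub> A) A L id s)" if s: "s \<in> carrier (A \<boxtimes>\<^bsub>K\<^esub> A)" for s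
      by (rule tensor_ext[OF Am Am tensor_module[OF VCA Am] linear_map_comp[OF assoc_left_pure_linear[OF V Am Am v] \<Lambda>i]
            linear_map_comp[OF tensor_map_linear[OF Am Am CA Am L i] \<Theta>] _ s])
        (simp add: v assoc_left_pure[OF V Am Am] tensor_map_pure[OF VA Am VCA Am \<Lambda> i]
          pure_tensor_closed[OF V] \<Lambda>_pure tensor_map_pure[OF Am Am CA Am L i] \<Theta>_pure linear_map_closed[OF L])
    have 2: "assoc_left K (V \<boxtimes>\<^bsub>K\<^esub> C) A A (pure_tensor K (V \<boxtimes>\<^bsub>K\<^esub> C) (A \<boxtimes>\<^bsub>K\<^esub> A) (pure_tensor K V C v c) s)
        = \<Theta> (assoc_left K C A A (pure_tensor K C (A \<boxtimes>\<^bsub>K\<^esub> A) c s))"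
      if c: "c \<in> carrier C" and s: "s \<in> carrier (A \<boxtimes>\<^bsub>K\<^esub> A)" for c s
      by (rule tensor_ext[OF Am Am tensor_module[OF VCA Am]
            assoc_left_pure_linear[OF VC Am Am pure_tensor_closed[OF V v c]]
            linear_map_comp[OF assoc_left_pure_linear[OF C Am Am c] \<Theta>] _ s])
        (simp add: v c assoc_left_pure[OF VC Am Am] assoc_left_pure[OF C Am Am]
          pure_tensor_closed[OF V] pure_tensor_closed[OF C] \<Theta>_pure \<theta>_pure)
    have 3: "id_tensor_comult K A (V \<boxtimes>\<^bsub>K\<^esub> C) (\<theta> u) = \<Theta> (id_tensor_comult K A C u)"
      if u: "u \<in> carrier (C \<boxtimes>\<^bsub>K\<^esub> A)" for u
      by (rule tensor_ext[OF C Am tensor_module[OF VCA Am] linear_map_comp[OF \<theta> \<delta>VC] linear_map_comp[OF \<delta>C \<Theta>] _ u])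
        (simp add: v \<theta>_pure id_tensor_comult_pure[OF A VC] id_tensor_comult_pure[OF A C]
          pure_tensor_closed[OF V] 2 linear_map_closed[OF \<Delta>])
    have "tensor_map K ((V \<boxtimes>\<^bsub>K\<^esub> C) \<boxtimes>\<^bsub>K\<^esub> A) A \<Lambda> id (id_tensor_comult K A V (pure_tensor K V A v a))
        = \<Theta> (tensor_map K (C \<boxtimes>\<^bsub>K\<^esub> A) A L id (comult A a))"
      using v a by (simp add: id_tensor_comult_pure[OF A V] 1 linear_map_closed[OF \<Delta>])
    also have "\<dots> = id_tensor_comult K A (V \<boxtimes>\<^bsub>K\<^esub> C) (\<Lambda> (pure_tensor K V A v a))"
      using a by (simp add: L_coaction[symmetric] 3 linear_map_closed[OF L] \<Lambda>_pure)
    finally show "tensor_map K ((V \<boxtimes>\<^bsub>K\<^esub> C) \<boxtimes>\<^bsub>K\<^esub> A) A \<Lambda> id (id_tensor_comult K A V (pure_tensor K V A v a))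
        = id_tensor_comult K A (V \<boxtimes>\<^bsub>K\<^esub> C) (\<Lambda> (pure_tensor K V A v a))" .
  qed
  then show ?thesis by (simp add: \<Lambda>_def)
qed

lemma id_tensor_comult_corepresentation:
  assumes A: "coalgebra K A" and V: "module K V"
  shows "right_corepresentation K A (V \<boxtimes>\<^bsub>K\<^esub> A) (id_tensor_comult K A V)"
proof -
  interpret A: coalgebra K A by fact
  have Am: "module K A" by (rule A.module_axioms)
  note \<Delta> = A.comult_linear
  note VA = tensor_module[OF V Am] and AA = tensor_module[OF Am Am]
  note \<delta> = id_tensor_comult_linear[OF A V]
  note BVA = bilinear_scale_right[OF VA Am A.counit_linear] and BA = bilinear_scale_right[OF Am Am A.counit_linear]
  have coassoc: "tensor_map K ((V \<boxtimes>\<^bsub>K\<^esub> A) \<boxtimes>\<^bsub>K\<^esub> A) A (id_tensor_comult K A V) id (id_tensor_comult K A V F)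
      = assoc_left K (V \<boxtimes>\<^bsub>K\<^esub> A) A A (tensor_map K (V \<boxtimes>\<^bsub>K\<^esub> A) (A \<boxtimes>\<^bsub>K\<^esub> A) id (comult A) (id_tensor_comult K A V F))"
    if F: "F \<in> carrier (V \<boxtimes>\<^bsub>K\<^esub> A)" for F
    using id_tensor_comult_intertwines[OF A V Am \<Delta> _ F] A.coassoc
    unfolding id_tensor_comult_def by simp
  have counit: "tensor_lift K (V \<boxtimes>\<^bsub>K\<^esub> A) (\<lambda>x c. counit A c \<odot>\<^bsub>V \<boxtimes>\<^bsub>K\<^esub> A\<^esub> x) (id_tensor_comult K A V F) = F"
    if F: "F \<in> carrier (V \<boxtimes>\<^bsub>K\<^esub> A)" for F
  proof (rule tensor_ext[OF V Am VA linear_map_comp[OF \<delta> tensor_lift_linear[OF VA Am VA BVA]] linear_map_ident _ F])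
    fix v a assume v: "v \<in> carrier V" and a: "a \<in> carrier A"
    note p = pure_tensor_linear_right[OF V Am v]
    have \<epsilon>: "counit A x \<in> carrier K" if "x \<in> carrier A" for x
      using linear_map_closed[OF A.counit_linear that] by (simp add: ground_module_def)
    have "tensor_lift K (V \<boxtimes>\<^bsub>K\<^esub> A) (\<lambda>x c. counit A c \<odot>\<^bsub>V \<boxtimes>\<^bsub>K\<^esub> A\<^esub> x)
        (assoc_left K V A A (pure_tensor K V (A \<boxtimes>\<^bsub>K\<^esub> A) v s))
      = pure_tensor K V A v (tensor_lift K A (\<lambda>x c. counit A c \<odot>\<^bsub>A\<^esub> x) s)"
      if s: "s \<in> carrier (A \<boxtimes>\<^bsub>K\<^esub> A)" for s
      by (rule tensor_ext[OF Am Am VA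
            linear_map_comp[OF assoc_left_pure_linear[OF V Am Am v] tensor_lift_linear[OF VA Am VA BVA]]
            linear_map_comp[OF tensor_lift_linear[OF Am Am Am BA] p] _ s])
        (simp add: v assoc_left_pure[OF V Am Am] tensor_lift_pure[OF VA Am VA BVA] pure_tensor_closed[OF V]
          tensor_lift_pure[OF Am Am Am BA] linear_map_smult[OF p] \<epsilon>)
    then show "tensor_lift K (V \<boxtimes>\<^bsub>K\<^esub> A) (\<lambda>x c. counit A c \<odot>\<^bsub>V \<boxtimes>\<^bsub>K\<^esub> A\<^esub> x)
        (id_tensor_comult K A V (pure_tensor K V A v a)) = pure_tensor K V A v a"
      using v a by (simp add: id_tensor_comult_pure[OF A V] linear_map_closed[OF \<Delta>] A.counit_right)
  qed
  show ?thesis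
    unfolding right_corepresentation_def using VA \<delta> coassoc counit by auto
qed

section \<open>Induced corepresentations\<close>

lemma L_coaction_linear:
  assumes A: "coalgebra K A" and C: "module K C" and \<pi>: "linear_map K A C \<pi>"
  shows "linear_map K A (C \<boxtimes>\<^bsub>K\<^esub> A) (L_coaction K A C \<pi>)"
proof -
  interpret A: coalgebra K A by fact
  have Am: "module K A" by (rule A.module_axioms)
  show ?thesis
    unfolding L_coaction_def
    by (rule linear_map_comp[OF A.comult_linear tensor_map_linear[OF Am Am C Am \<pi> linear_map_id]])
qed

text \<open>
  Coassociativity of \<open>\<Delta>\<close>, with \<open>\<pi>\<close> applied to the first factor.
\<close>

lemma L_coaction_comult:
  assumes A: "coalgebra K A" and C: "module K C" and \<pi>: "linear_map K A C \<pi>" and a: "a \<in> carrier A"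
  shows "id_tensor_comult K A C (L_coaction K A C \<pi> a)
    = tensor_map K (C \<boxtimes>\<^bsub>K\<^esub> A) A (L_coaction K A C \<pi>) id (comult A a)"
proof -
  interpret A: coalgebra K A by fact
  have Am: "module K A" by (rule A.module_axioms)
  note i = linear_map_id and \<Delta> = A.comult_linear
  note AA = tensor_module[OF Am Am] and CA = tensor_module[OF C Am]
  note \<Delta>a = linear_map_closed[OF \<Delta> a]
  have "id_tensor_comult K A C (L_coaction K A C \<pi> a)
      = tensor_map K (C \<boxtimes>\<^bsub>K\<^esub> A) A (tensor_map K C A \<pi> id) id (id_tensor_comult K A A (comult A a))"
    unfolding L_coaction_def by (rule id_tensor_comult_natural[OF A Am C \<pi> \<Delta>a, symmetric])
  also have "id_tensor_comult K A A (comult A a) = tensor_map K (A \<boxtimes>\<^bsub>K\<^esub> A) A (comult A) id (comult A a)"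
    unfolding id_tensor_comult_def by (rule A.coassoc[OF a, symmetric])
  also have "tensor_map K (C \<boxtimes>\<^bsub>K\<^esub> A) A (tensor_map K C A \<pi> id) id \<dots>
      = tensor_map K (C \<boxtimes>\<^bsub>K\<^esub> A) A (L_coaction K A C \<pi>) id (comult A a)"
    by (rule tensor_map_comp[OF Am Am AA Am CA Am \<Delta> i tensor_map_linear[OF Am Am C Am \<pi> i] i _ _ \<Delta>a])
      (simp_all add: L_coaction_def)
  finally show ?thesis .
qed

text \<open>
  For every linear \<open>\<rho>\<close>, both \<open>id \<otimes> L\<close> and \<open>\<rho> \<otimes> id\<close> commute with \<open>id \<otimes> \<Delta>\<close>, so
  \<open>id \<otimes> \<Delta>\<close> maps their equalizer into the equalizer of the maps tensored with \<open>id\<close>, and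
  \<open>tensor_equalizer\<close> identifies the latter.
\<close>

theorem ind_corepresentation:
  assumes K: "field K" and A: "coalgebra K A" and C: "module K C" and V: "module K V"
    and \<pi>: "linear_map K A C \<pi>" and \<rho>: "linear_map K V (V \<boxtimes>\<^bsub>K\<^esub> C) \<rho>"
  shows "right_corepresentation K A (subspace_module (V \<boxtimes>\<^bsub>K\<^esub> A) (ind K A C \<pi> V \<rho>))
    (restricted_coaction K A (V \<boxtimes>\<^bsub>K\<^esub> A) (ind K A C \<pi> V \<rho>) (id_tensor_comult K A V))"
proof -
  interpret A: coalgebra K A by fact
  have Am: "module K A" by (rule A.module_axioms)
  note i = linear_map_id
  note VC = tensor_module[OF V C] and CA = tensor_module[OF C Am] and VA = tensor_module[OF V Am]
  note VCA = tensor_module[OF VC Am]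
  note L = L_coaction_linear[OF A C \<pi>]
  define \<Lambda> where "\<Lambda> F = assoc_left K V C A (tensor_map K V (C \<boxtimes>\<^bsub>K\<^esub> A) id (L_coaction K A C \<pi>) F)" for F
  have \<Lambda>: "linear_map K (V \<boxtimes>\<^bsub>K\<^esub> A) ((V \<boxtimes>\<^bsub>K\<^esub> C) \<boxtimes>\<^bsub>K\<^esub> A) \<Lambda>"
    unfolding \<Lambda>_def
    by (rule linear_map_comp[OF tensor_map_linear[OF V Am V CA i L] assoc_left_linear[OF V C Am]])
  note R = tensor_map_linear[OF V Am VC Am \<rho> i]
  have ind: "ind K A C \<pi> V \<rho> = {F \<in> carrier (V \<boxtimes>\<^bsub>K\<^esub> A). \<Lambda> F = tensor_map K (V \<boxtimes>\<^bsub>K\<^esub> C) A \<rho> id F}"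
    by (simp add: ind_def \<Lambda>_def)
  show ?thesis
  proof (rule right_corepresentation_restrict[OF K A id_tensor_comult_corepresentation[OF A V]])
    show "submodule (ind K A C \<pi> V \<rho>) K (V \<boxtimes>\<^bsub>K\<^esub> A)"
      unfolding ind by (rule equalizer_submodule[OF VA VCA \<Lambda> R])
  next
    fix F assume "F \<in> ind K A C \<pi> V \<rho>"
    then have F: "F \<in> carrier (V \<boxtimes>\<^bsub>K\<^esub> A)" and eq: "\<Lambda> F = tensor_map K (V \<boxtimes>\<^bsub>K\<^esub> C) A \<rho> id F"
      by (auto simp: ind)
    have "tensor_map K ((V \<boxtimes>\<^bsub>K\<^esub> C) \<boxtimes>\<^bsub>K\<^esub> A) A \<Lambda> id (id_tensor_comult K A V F)
        = id_tensor_comult K A (V \<boxtimes>\<^bsub>K\<^esub> C) (\<Lambda> F)"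
      unfolding \<Lambda>_def by (rule id_tensor_comult_intertwines[OF A V C L L_coaction_comult[OF A C \<pi>] F])
    also have "\<dots> = tensor_map K ((V \<boxtimes>\<^bsub>K\<^esub> C) \<boxtimes>\<^bsub>K\<^esub> A) A (tensor_map K (V \<boxtimes>\<^bsub>K\<^esub> C) A \<rho> id) id (id_tensor_comult K A V F)"
      unfolding eq by (rule id_tensor_comult_natural[OF A V VC \<rho> F, symmetric])
    finally show "id_tensor_comult K A V F \<in> tensor_map K (V \<boxtimes>\<^bsub>K\<^esub> A) A id id `
        carrier (subspace_module (V \<boxtimes>\<^bsub>K\<^esub> A) (ind K A C \<pi> V \<rho>) \<boxtimes>\<^bsub>K\<^esub> A)"
      unfolding ind
      by (rule tensor_equalizer[OF K VA Am VCA \<Lambda> R linear_map_closed[OF id_tensor_comult_linear[OF A V] F]])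
  qed
qed

text \<open>
  \<open>(\<pi> \<otimes> id) \<Delta> \<alpha> = (\<pi> \<alpha> \<otimes> \<alpha>) \<Delta> = (\<alpha>' \<pi> \<otimes> \<alpha>) \<Delta>\<close>.
\<close>

lemma L_coaction_automorphism:
  assumes A: "coalgebra K A" and C: "module K C" and \<pi>: "linear_map K A C \<pi>"
    and \<alpha>: "coalgebra_hom K A A \<alpha>" and \<alpha>': "linear_map K C C \<alpha>'"
    and \<alpha>\<pi>: "\<And>a. a \<in> carrier A \<Longrightarrow> \<alpha>' (\<pi> a) = \<pi> (\<alpha> a)" and a: "a \<in> carrier A"
  shows "L_coaction K A C \<pi> (\<alpha> a) = tensor_map K C A \<alpha>' \<alpha> (L_coaction K A C \<pi> a)"
proof -
  interpret A: coalgebra K A by fact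
  have Am: "module K A" by (rule A.module_axioms)
  note i = linear_map_id and \<Delta> = A.comult_linear
  have \<alpha>l: "linear_map K A A \<alpha>" and \<alpha>\<Delta>: "comult A (\<alpha> a) = tensor_map K A A \<alpha> \<alpha> (comult A a)"
    using \<alpha> a by (auto simp: coalgebra_hom_def)
  note \<Delta>a = linear_map_closed[OF \<Delta> a]
  have "L_coaction K A C \<pi> (\<alpha> a) = tensor_map K C A (\<lambda>x. \<pi> (\<alpha> x)) \<alpha> (comult A a)"
    unfolding L_coaction_def \<alpha>\<Delta>
    by (rule tensor_map_comp[OF Am Am Am Am C Am \<alpha>l \<alpha>l \<pi> i _ _ \<Delta>a]) simp_all
  also have "\<dots> = tensor_map K C A \<alpha>' \<alpha> (L_coaction K A C \<pi> a)"
    unfolding L_coaction_def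
    by (rule tensor_map_comp[OF Am Am C Am C Am \<pi> i \<alpha>' \<alpha>l _ _ \<Delta>a, symmetric]) (simp_all add: \<alpha>\<pi>)
  finally show ?thesis .
qed

text \<open>
  With \<open>\<Lambda>\<close> for \<open>id \<otimes> L\<close> followed by the associator, \<open>T = id \<otimes> \<alpha>\<close> and
  \<open>\<Theta> = (id \<otimes> \<alpha>') \<otimes> \<alpha>\<close>, one has \<open>\<Lambda> T = \<Theta> \<Lambda>\<close> and
  \<open>((id \<otimes> \<alpha>') \<rho> \<otimes> id) T = \<Theta> (\<rho> \<otimes> id)\<close>. As \<open>\<Theta>\<close> is injective, \<open>T F\<close> satisfies the
  defining equation of the left-hand space exactly when \<open>F\<close> satisfies that of \<open>ind \<rho>\<close>.
\<close>

theorem ind_automorphism: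
  assumes A: "coalgebra K A" and C: "module K C" and V: "module K V"
    and \<pi>: "linear_map K A C \<pi>" and \<rho>: "linear_map K V (V \<boxtimes>\<^bsub>K\<^esub> C) \<rho>"
    and \<alpha>: "coalgebra_hom K A A \<alpha>" "bij_betw \<alpha> (carrier A) (carrier A)"
    and \<alpha>': "linear_map K C C \<alpha>'" "bij_betw \<alpha>' (carrier C) (carrier C)"
    and \<alpha>\<pi>: "\<And>a. a \<in> carrier A \<Longrightarrow> \<alpha>' (\<pi> a) = \<pi> (\<alpha> a)"
  shows "ind K A C \<pi> V (\<lambda>v. tensor_map K V C id \<alpha>' (\<rho> v)) = tensor_map K V A id \<alpha> ` ind K A C \<pi> V \<rho>"
proof -
  interpret A: coalgebra K A by fact
  have Am: "module K A" by (rule A.module_axioms)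
  note i = linear_map_id and \<Delta> = A.comult_linear
  have \<alpha>l: "linear_map K A A \<alpha>" using \<alpha> by (auto simp: coalgebra_hom_def)
  note VC = tensor_module[OF V C] and CA = tensor_module[OF C Am] and VA = tensor_module[OF V Am]
  note VCA = tensor_module[OF VC Am]
  note L = L_coaction_linear[OF A C \<pi>]
  let ?\<rho>' = "\<lambda>v. tensor_map K V C id \<alpha>' (\<rho> v)"
  let ?\<Lambda> = "\<lambda>F. assoc_left K V C A (tensor_map K V (C \<boxtimes>\<^bsub>K\<^esub> A) id (L_coaction K A C \<pi>) F)"
  let ?\<Theta> = "tensor_map K (V \<boxtimes>\<^bsub>K\<^esub> C) A (tensor_map K V C id \<alpha>') \<alpha>"
  let ?T = "tensor_map K V A id \<alpha>"
  note ia' = tensor_map_linear[OF V C V C i \<alpha>'(1)] and aa = tensor_map_linear[OF C Am C Am \<alpha>'(1) \<alpha>l]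
  note \<rho>' = linear_map_comp[OF \<rho> ia']
  have T: "bij_betw ?T (carrier (V \<boxtimes>\<^bsub>K\<^esub> A)) (carrier (V \<boxtimes>\<^bsub>K\<^esub> A))"
    by (rule tensor_map_bij_betw[OF V Am V Am i \<alpha>l _ \<alpha>(2)]) simp
  have "bij_betw (tensor_map K V C id \<alpha>') (carrier (V \<boxtimes>\<^bsub>K\<^esub> C)) (carrier (V \<boxtimes>\<^bsub>K\<^esub> C))"
    by (rule tensor_map_bij_betw[OF V C V C i \<alpha>'(1) _ \<alpha>'(2)]) simp
  then have \<Theta>: "inj_on ?\<Theta> (carrier ((V \<boxtimes>\<^bsub>K\<^esub> C) \<boxtimes>\<^bsub>K\<^esub> A))"
    using tensor_map_bij_betw[OF VC Am VC Am ia' \<alpha>l _ \<alpha>(2)] by (auto simp: bij_betw_def)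
  have iff: "?T F \<in> ind K A C \<pi> V ?\<rho>' \<longleftrightarrow> F \<in> ind K A C \<pi> V \<rho>" if F: "F \<in> carrier (V \<boxtimes>\<^bsub>K\<^esub> A)" for F
  proof -
    note LF = tensor_map_closed[OF V Am V CA i L F]
    have "?\<Lambda> (?T F) = assoc_left K V C A (tensor_map K V (C \<boxtimes>\<^bsub>K\<^esub> A) id (\<lambda>a. L_coaction K A C \<pi> (\<alpha> a)) F)"
      by (rule arg_cong[of _ _ "assoc_left K V C A"],
          rule tensor_map_comp[OF V Am V Am V CA i \<alpha>l i L _ _ F]) simp_all
    also have "tensor_map K V (C \<boxtimes>\<^bsub>K\<^esub> A) id (\<lambda>a. L_coaction K A C \<pi> (\<alpha> a)) F
        = tensor_map K V (C \<boxtimes>\<^bsub>K\<^esub> A) id (tensor_map K C A \<alpha>' \<alpha>)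
            (tensor_map K V (C \<boxtimes>\<^bsub>K\<^esub> A) id (L_coaction K A C \<pi>) F)"
      by (rule tensor_map_comp[OF V Am V CA V CA i L i aa _ _ F, symmetric])
        (simp_all add: L_coaction_automorphism[OF A C \<pi> \<alpha>(1) \<alpha>'(1) \<alpha>\<pi>])
    also have "assoc_left K V C A \<dots> = ?\<Theta> (?\<Lambda> F)"
      by (rule assoc_left_natural[OF V C Am V C Am i \<alpha>'(1) \<alpha>l LF])
    finally have 1: "?\<Lambda> (?T F) = ?\<Theta> (?\<Lambda> F)" .
    have "tensor_map K (V \<boxtimes>\<^bsub>K\<^esub> C) A ?\<rho>' id (?T F) = tensor_map K (V \<boxtimes>\<^bsub>K\<^esub> C) A ?\<rho>' \<alpha> F"
      by (rule tensor_map_comp[OF V Am V Am VC Am i \<alpha>l \<rho>' i _ _ F]) simp_all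
    also have "\<dots> = ?\<Theta> (tensor_map K (V \<boxtimes>\<^bsub>K\<^esub> C) A \<rho> id F)"
      by (rule tensor_map_comp[OF V Am VC Am VC Am \<rho> i ia' \<alpha>l _ _ F, symmetric]) simp_all
    finally have 2: "tensor_map K (V \<boxtimes>\<^bsub>K\<^esub> C) A ?\<rho>' id (?T F) = ?\<Theta> (tensor_map K (V \<boxtimes>\<^bsub>K\<^esub> C) A \<rho> id F)" .
    have "?\<Theta> (?\<Lambda> F) = ?\<Theta> (tensor_map K (V \<boxtimes>\<^bsub>K\<^esub> C) A \<rho> id F)
        \<longleftrightarrow> ?\<Lambda> F = tensor_map K (V \<boxtimes>\<^bsub>K\<^esub> C) A \<rho> id F"
      by (rule inj_on_eq_iff[OF \<Theta> assoc_left_closed[OF V C Am LF] tensor_map_closed[OF V Am VC Am \<rho> i F]])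
    moreover have "?T F \<in> carrier (V \<boxtimes>\<^bsub>K\<^esub> A)" by (rule tensor_map_closed[OF V Am V Am i \<alpha>l F])
    ultimately show ?thesis using F 1 2 by (simp add: ind_def)
  qed
  have sub: "ind K A C \<pi> V \<sigma> \<subseteq> carrier (V \<boxtimes>\<^bsub>K\<^esub> A)" for \<sigma> by (auto simp: ind_def)
  show ?thesis
  proof (intro equalityI subsetI)
    fix G assume G: "G \<in> ind K A C \<pi> V ?\<rho>'"
    then obtain F where "F \<in> carrier (V \<boxtimes>\<^bsub>K\<^esub> A)" "G = ?T F"
      using T sub unfolding bij_betw_def by blast
    then show "G \<in> ?T ` ind K A C \<pi> V \<rho>" using G iff by blast
  next
    fix G assume "G \<in> ?T ` ind K A C \<pi> V \<rho>"
    then show "G \<in> ind K A C \<pi> V ?\<rho>'" using iff sub by blast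
  qed
qed

lemma equivalent_corepresentations_refl:
  assumes A: "module K A" and \<rho>: "right_corepresentation K A V \<rho>"
  shows "equivalent_corepresentations K A V \<rho> V \<rho>"
proof -
  have V: "module K V" and l: "linear_map K V (V \<boxtimes>\<^bsub>K\<^esub> A) \<rho>"
    using \<rho> by (auto simp: right_corepresentation_def)
  have "tensor_map K V A id id (\<rho> v) = \<rho> (id v)" if "v \<in> carrier V" for v
    using tensor_map_id[OF V A linear_map_closed[OF l that]] by simp
  then show ?thesis
    unfolding equivalent_corepresentations_def using \<rho>
    by (intro conjI exI[of _ id] linear_map_id bij_betw_id) auto
qed

theorem proposition3p9:
  fixes K :: "('k, 'r) ring_scheme"
    and A :: "('k, 'a, 'm) hopf_algebra_scheme"
    and C :: "('k, 'c, 'n) coalgebra_scheme"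
    and V :: "('k, 'v, 'l) module_scheme"
    and \<pi> :: "'a \<Rightarrow> 'c" and \<alpha> :: "'a \<Rightarrow> 'a" and \<alpha>' :: "'c \<Rightarrow> 'c"
    and \<rho> :: "'v \<Rightarrow> ('v \<times> 'c \<Rightarrow> 'k) set"
  assumes "field K"
    and "\<And>n::nat. n > 0 \<Longrightarrow> [n] \<cdot>\<^bsub>K\<^esub> \<one>\<^bsub>K\<^esub> \<noteq> \<zero>\<^bsub>K\<^esub>"
    and "hopf_algebra K A"
    and "left_coisotropic_quantum_subgroup K A C \<pi> \<or> right_coisotropic_quantum_subgroup K A C \<pi>"
    and "hopf_automorphism K A \<alpha>"
    and "coalgebra_automorphism K C \<alpha>'"
    and "\<And>a. a \<in> carrier A \<Longrightarrow> \<alpha>' (\<pi> a) = \<pi> (\<alpha> a)"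
    and "right_corepresentation K C V \<rho>"
  shows "let I = ind K A C \<pi> V (\<lambda>v. tensor_map K V C id \<alpha>' (\<rho> v));
             J = tensor_map K V A id \<alpha> ` ind K A C \<pi> V \<rho>
         in I = J \<and>
            equivalent_corepresentations K A
              (subspace_module (V \<boxtimes>\<^bsub>K\<^esub> A) I)
              (restricted_coaction K A (V \<boxtimes>\<^bsub>K\<^esub> A) I (id_tensor_comult K A V))
              (subspace_module (V \<boxtimes>\<^bsub>K\<^esub> A) J)
              (restricted_coaction K A (V \<boxtimes>\<^bsub>K\<^esub> A) J (id_tensor_comult K A V))"
proof -
  have A: "coalgebra K A" using assms(3) by (simp add: hopf_algebra_def)
  then have Am: "module K A" by (simp add: coalgebra_def)
  have "coalgebra K C" and \<pi>: "linear_map K A C \<pi>"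
    using assms(4) by (auto simp: left_coisotropic_quantum_subgroup_def
        right_coisotropic_quantum_subgroup_def coalgebra_hom_def)
  then have C: "module K C" by (simp add: coalgebra_def)
  have V: "module K V" and \<rho>: "linear_map K V (V \<boxtimes>\<^bsub>K\<^esub> C) \<rho>"
    using assms(8) by (auto simp: right_corepresentation_def)
  have \<alpha>: "coalgebra_hom K A A \<alpha>" "bij_betw \<alpha> (carrier A) (carrier A)"
    using assms(5) by (auto simp: hopf_automorphism_def)
  have \<alpha>': "linear_map K C C \<alpha>'" "bij_betw \<alpha>' (carrier C) (carrier C)"
    using assms(6) by (auto simp: coalgebra_automorphism_def coalgebra_hom_def)
  have \<rho>': "linear_map K V (V \<boxtimes>\<^bsub>K\<^esub> C) (\<lambda>v. tensor_map K V C id \<alpha>' (\<rho> v))"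
    by (rule linear_map_comp[OF \<rho> tensor_map_linear[OF V C V C linear_map_id \<alpha>'(1)]])
  have eq: "ind K A C \<pi> V (\<lambda>v. tensor_map K V C id \<alpha>' (\<rho> v)) = tensor_map K V A id \<alpha> ` ind K A C \<pi> V \<rho>"
    by (rule ind_automorphism[OF A C V \<pi> \<rho> \<alpha> \<alpha>']) (rule assms(7))
  show ?thesis
    unfolding Let_def eq[symmetric]
    by (intro conjI refl equivalent_corepresentations_refl[OF Am]
        ind_corepresentation[OF assms(1) A C V \<pi> \<rho>'])
qed

end
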